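(* Let $D>1$ be a square-free integer with $D\equiv 1\pmod 4$. Let $n\ge 1$ be an integer and let $\nu\bmod n$ satisfy $\nu^2\equiv D\pmod n$. Then there exists a finite set of oriented geodesics $\{\mathbf{c}_1,\dots,\mathbf{c}_h\}$ in $\mathbb{H}$ with the following properties: (i) For every positive integer $m$ and every residue class $\mu\bmod m$ with $\mu^2\equiv D\pmod m$, $m\equiv 0\pmod n$ and $\mu\equiv \nu\pmod n$, there exist a unique $k\in\{1,\dots,h\}$ and a unique double coset $\Gamma_\infty\gamma\Gamma_{\mathbf{c}_k}\in \Gamma_\infty\backslash\Gamma_0(n)/\Gamma_{\mathbf{c}_k}$ with $\gamma\mathbf{c}_k$ positively oriented such that $$z_{\gamma\mathbf{c}_k}\equiv \frac{\mu}{m}+\mathrm{i}\frac{\sqrt D}{m}\pmod{\Gamma_\infty}.$$ (ii) Conversely, for every $k\in\{1,\dots,h\}$ and every double coset $\Gamma_\infty\gamma\Gamma_{\mathbf{c}_k}\in\Gamma_\infty\backslash\Gamma_0(n)/\Gamma_{\mathbf{c}_k}$ with $\gamma\mathbf{c}_k$ positively oriented, there exist a unique positive integer $m$ and a unique residue class $\mu\bmod m$ with $\mu^2\equiv D\pmod m$, $m\equiv 0\pmod n$ and $\mu\equiv\nu\pmod n$ such that the congruence displayed in (i) holds.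
   Context: $\mathbb{H}=\{z\in\mathbb{C}:\operatorname{Im}z>0\}$ with $\operatorname{SL}(2,\mathbb{R})$ acting by Möbius transformations $z\mapsto \frac{az+b}{cz+d}$. An oriented geodesic is a set $\mathbf{c}=\{g\,\mathrm{diag}(s,s^{-1})\,\mathrm{i}: s>0\}$ for some $g\in\operatorname{SL}(2,\mathbb{R})$, oriented by increasing $s$; its backward endpoint $\mathbf{c}^-$ (limit $s\to0$) and forward endpoint $\mathbf{c}^+$ (limit $s\to\infty$) lie in $\mathbb{R}\cup\{\infty\}$. $\mathbf{c}$ is positively oriented if both endpoints are real and $\mathbf{c}^-<\mathbf{c}^+$; then $z_{\mathbf{c}}$ (the top of $\mathbf{c}$) is the point of $\mathbf{c}$ with largest imaginary part. $\Gamma_\infty=\{\pm\begin{pmatrix}1&k\\0&1\end{pmatrix}:k\in\mathbb{Z}\}$, and $z\equiv w\pmod{\Gamma_\infty}$ means $w=\gamma z$ for some $\gamma\in\Gamma_\infty$ (i.e. $w-z\in\mathbb{Z}$). $\Gamma_0(n)=\{\begin{pmatrix}a&b\\c&d\end{pmatrix}\in\operatorname{SL}(2,\mathbb{Z}):c\equiv0\pmod n\}$. For $\mathbf{c}=g\{\mathrm{diag}(s,s^{-1})\mathrm{i}\}$, $\Gamma_{\mathbf{c}}=\Gamma_0(n)\cap\{\pm g\,\mathrm{diag}(s,s^{-1})g^{-1}:s>0\}$ is its (orientation-preserving) stabilizer in $\Gamma_0(n)$. *)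

theory Defs
  imports "HOL-Analysis.Analysis" "HOL-Number_Theory.Cong" "HOL-Computational_Algebra.Squarefree"
begin

definition mat2 :: "real \<Rightarrow> real \<Rightarrow> real \<Rightarrow> real \<Rightarrow> real^2^2" where
  "mat2 a b c d = vector [vector [a, b], vector [c, d]]"

definition SL2R :: "(real^2^2) set" where
  "SL2R = {g. det g = 1}"

definition mobius_act :: "real^2^2 \<Rightarrow> complex \<Rightarrow> complex" where
  "mobius_act g = moebius (of_real (g$1$1)) (of_real (g$1$2)) (of_real (g$2$1)) (of_real (g$2$2))"

definition diag2 :: "real \<Rightarrow> real^2^2" where
  "diag2 s = mat2 s 0 0 (inverse s)"

text \<open>
  An oriented geodesic is encoded as the linear order that increasing \<open>s\<close> induces on its
  points \<open>g diag(s, 1/s) \<i>\<close>. The order is reflexive, so the underlying point set is its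
  \<open>Field\<close>, and two matrices \<open>g\<close> give the same oriented geodesic iff they give the same
  point set with the same direction.
\<close>

type_synonym oriented_curve = "(complex \<times> complex) set"

definition geodesic_param :: "real^2^2 \<Rightarrow> real \<Rightarrow> complex" where
  "geodesic_param g s = mobius_act (g ** diag2 s) \<i>"

definition geodesic_of :: "real^2^2 \<Rightarrow> oriented_curve" where
  "geodesic_of g = {(geodesic_param g s, geodesic_param g t) | s t. 0 < s \<and> s \<le> t}"

definition oriented_geodesic :: "oriented_curve \<Rightarrow> bool" where
  "oriented_geodesic c \<longleftrightarrow> (\<exists>g\<in>SL2R. c = geodesic_of g)"

definition act_geodesic :: "real^2^2 \<Rightarrow> oriented_curve \<Rightarrow> oriented_curve" where
  "act_geodesic \<gamma> c = map_prod (mobius_act \<gamma>) (mobius_act \<gamma>) ` c"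

text \<open>
  Only real endpoints are named: an oriented geodesic whose endpoint is \<open>\<infinity>\<close> satisfies the
  corresponding predicate for no real \<open>x\<close>. The limits do not depend on which \<open>g\<close> with
  \<open>c = geodesic_of g\<close> is used.
\<close>

definition backward_endpoint :: "oriented_curve \<Rightarrow> real \<Rightarrow> bool" where
  "backward_endpoint c x \<longleftrightarrow>
     (\<exists>g\<in>SL2R. c = geodesic_of g \<and> (geodesic_param g \<longlongrightarrow> of_real x) (at_right 0))"

definition forward_endpoint :: "oriented_curve \<Rightarrow> real \<Rightarrow> bool" where
  "forward_endpoint c x \<longleftrightarrow>
     (\<exists>g\<in>SL2R. c = geodesic_of g \<and> (geodesic_param g \<longlongrightarrow> of_real x) at_top)"

definition positively_oriented :: "oriented_curve \<Rightarrow> bool" where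
  "positively_oriented c \<longleftrightarrow>
     (\<exists>x y. backward_endpoint c x \<and> forward_endpoint c y \<and> x < y)"

definition geodesic_top :: "oriented_curve \<Rightarrow> complex" where
  "geodesic_top c = arg_max_on Im (Field c)"

definition Gamma_inf :: "(real^2^2) set" where
  "Gamma_inf = {\<gamma>. \<exists>k::int. \<gamma> = mat2 1 (of_int k) 0 1 \<or> \<gamma> = - mat2 1 (of_int k) 0 1}"

definition cong_Gamma_inf :: "complex \<Rightarrow> complex \<Rightarrow> bool" where
  "cong_Gamma_inf z w \<longleftrightarrow> (\<exists>\<gamma>\<in>Gamma_inf. w = mobius_act \<gamma> z)"

definition Gamma0 :: "int \<Rightarrow> (real^2^2) set" where
  "Gamma0 n = {mat2 (of_int a) (of_int b) (of_int c) (of_int d) | a b c d :: int.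
                 a * d - b * c = 1 \<and> [c = 0] (mod n)}"

text \<open>
  If \<open>geodesic_of g = geodesic_of h\<close> with \<open>g, h \<in> SL2R\<close>, then \<open>h = \<plusminus> g diag(s, 1/s)\<close> for some
  \<open>s > 0\<close>, so the existential over \<open>g\<close> does not enlarge the group given by a single \<open>g\<close>.
\<close>

definition geodesic_stabilizer :: "int \<Rightarrow> oriented_curve \<Rightarrow> (real^2^2) set" where
  "geodesic_stabilizer n c = Gamma0 n \<inter>
     {\<gamma>. \<exists>g\<in>SL2R. c = geodesic_of g \<and>
        (\<exists>s>0. \<gamma> = g ** diag2 s ** matrix_inv g \<or> \<gamma> = - (g ** diag2 s ** matrix_inv g))}"

definition double_coset ::
  "(real^2^2) set \<Rightarrow> real^2^2 \<Rightarrow> (real^2^2) set \<Rightarrow> (real^2^2) set" where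
  "double_coset A \<gamma> B = {\<alpha> ** \<gamma> ** \<beta> | \<alpha> \<beta>. \<alpha> \<in> A \<and> \<beta> \<in> B}"

definition residue_class :: "int \<Rightarrow> int \<Rightarrow> int set" where
  "residue_class m \<mu> = {x. [x = \<mu>] (mod m)}"

definition root_point :: "int \<Rightarrow> int \<Rightarrow> int \<Rightarrow> complex" where
  "root_point D m \<mu> = of_int \<mu> / of_int m + \<i> * (of_real (sqrt (of_int D)) / of_int m)"

definition admissible_root :: "int \<Rightarrow> int \<Rightarrow> int \<Rightarrow> int \<Rightarrow> int \<Rightarrow> bool" where
  "admissible_root D n \<nu> m \<mu> \<longleftrightarrow>
     m > 0 \<and> [\<mu>\<^sup>2 = D] (mod m) \<and> [m = 0] (mod n) \<and> [\<mu> = \<nu>] (mod n)"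

end

theory Submission
  imports Defs
begin

text \<open>
  A root \<open>\<mu> mod m\<close> gives the integral triple \<open>(A, B, C) = (m, \<mu>, (\<mu>\<^sup>2 - D) / m)\<close> with
  \<open>B\<^sup>2 - A C = D\<close>, that is, the traceless matrix with rows \<open>(B, -C)\<close> and \<open>(A, -B)\<close>. Such a
  triple determines the oriented geodesic from \<open>(B - \<surd>D) / A\<close> to \<open>(B + \<surd>D) / A\<close>, and is
  determined by it; the geodesic is positively oriented iff \<open>A > 0\<close>, and its top is then
  \<open>(B + \<i> \<surd>D) / A\<close>. Conjugation by \<open>\<Gamma>\<^sub>0(n)\<close> preserves the conditions \<open>n | A\<close> and
  \<open>B \<equiv> \<nu> (mod n)\<close>, because all matrices involved are upper triangular modulo \<open>n\<close>. Since \<open>D\<close> is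
  not a square, reduction theory leaves finitely many orbits, and the required geodesics are
  those of orbit representatives.
\<close>

section \<open>Geodesics and their axis forms\<close>

lemma mat2_nth [simp]:
  "mat2 a b c d $ 1 $ 1 = a" "mat2 a b c d $ 1 $ 2 = b"
  "mat2 a b c d $ 2 $ 1 = c" "mat2 a b c d $ 2 $ 2 = d"
  by (simp_all add: mat2_def)

lemma mat2_eq_iff [simp]:
  "mat2 a b c d = mat2 a' b' c' d' \<longleftrightarrow> a = a' \<and> b = b' \<and> c = c' \<and> d = d'"
  by (metis mat2_nth)

lemma mat2_cases: obtains a b c d where "g = mat2 a b c d"
proof
  show "g = mat2 (g$1$1) (g$1$2) (g$2$1) (g$2$2)"
    by (simp add: vec_eq_iff forall_2)
qed

lemma mat2_mult [simp]:
  "mat2 a b c d ** mat2 a' b' c' d' =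
     mat2 (a * a' + b * c') (a * b' + b * d') (c * a' + d * c') (c * b' + d * d')"
  by (simp add: vec_eq_iff forall_2 matrix_matrix_mult_def sum_2)

lemma mat2_uminus [simp]: "- mat2 a b c d = mat2 (-a) (-b) (-c) (-d)"
  by (simp add: vec_eq_iff forall_2)

lemma mat2_mult_minus [simp]:
  fixes g h :: "real^2^2"
  shows "(- g) ** h = - (g ** h)" "g ** (- h) = - (g ** h)"
  by (cases g rule: mat2_cases, cases h rule: mat2_cases, simp)+

lemma mat_1_eq_mat2: "mat 1 = mat2 1 0 0 1"
  by (simp add: vec_eq_iff forall_2 mat_def)

lemma mat2_in_SL2R [simp]: "mat2 a b c d \<in> SL2R \<longleftrightarrow> a * d - b * c = 1"
  by (simp add: SL2R_def det_2)

lemma SL2R_mult: "g \<in> SL2R \<Longrightarrow> h \<in> SL2R \<Longrightarrow> g ** h \<in> SL2R"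
  by (simp add: SL2R_def det_mul)

lemma SL2R_matrix_inv:
  assumes "g \<in> SL2R"
  shows "matrix_inv g \<in> SL2R" "matrix_inv g ** g = mat 1" "g ** matrix_inv g = mat 1"
proof -
  have "invertible g" using assms by (simp add: SL2R_def invertible_det_nz)
  hence "g ** matrix_inv g = mat 1 \<and> matrix_inv g ** g = mat 1"
    unfolding matrix_inv_def invertible_def by (rule someI_ex)
  thus inv: "matrix_inv g ** g = mat 1" "g ** matrix_inv g = mat 1" by auto
  have "det (matrix_inv g) * det g = 1"
    by (metis inv(1) det_mul det_I)
  thus "matrix_inv g \<in> SL2R" using assms by (simp add: SL2R_def)
qed

lemma mobius_act_mat2:
  "mobius_act (mat2 a b c d) z = (of_real a * z + of_real b) / (of_real c * z + of_real d)"
  by (simp add: mobius_act_def moebius_def)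

lemma mobius_act_uminus: "mobius_act (- g) z = mobius_act g z"
proof -
  obtain a b c d where g: "g = mat2 a b c d" by (rule mat2_cases)
  have "mobius_act (- g) z =
      (- (of_real a * z + of_real b)) / (- (of_real c * z + of_real d))"
    by (simp add: g mobius_act_mat2)
  thus ?thesis by (simp only: minus_divide_divide g mobius_act_mat2)
qed

text \<open>Only the inner denominator \<open>M\<close> has to be nonzero, which
  \<open>h \<in> SL2R\<close> and \<open>Im z > 0\<close> guarantee. If the outer denominator
  vanishes, both sides are 0 by the convention for division, so \<open>g\<close> can be
  arbitrary.\<close>

lemma mobius_act_mult:
  assumes "h \<in> SL2R" "Im z > 0"
  shows "mobius_act (g ** h) z = mobius_act g (mobius_act h z)"
proof -
  obtain a b c d where g: "g = mat2 a b c d" by (rule mat2_cases)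
  obtain a' b' c' d' where h: "h = mat2 a' b' c' d'" by (rule mat2_cases)
  define N where "N = of_real a' * z + of_real b'"
  define M where "M = of_real c' * z + of_real d'"
  have "M \<noteq> 0"
    using assms by (auto simp: M_def h complex_eq_iff)
  hence *: "of_real x * (N / M) + of_real y = (of_real x * N + of_real y * M) / M" for x y
    by (simp add: add_divide_distrib)
  have "mobius_act g (mobius_act h z) =
      (of_real a * N + of_real b * M) / (of_real c * N + of_real d * M)"
    using \<open>M \<noteq> 0\<close> unfolding g h mobius_act_mat2 N_def[symmetric] M_def[symmetric] * by simp
  also have "\<dots> = mobius_act (g ** h) z"
    unfolding g h mat2_mult mobius_act_mat2 N_def M_def by (simp add: algebra_simps)
  finally show ?thesis by simp
qed

lemma mobius_act_imaginary_unit: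
  assumes "a * d - b * c = 1"
  shows "mobius_act (mat2 a b c d) \<i> = Complex ((a*c + b*d) / (c\<^sup>2 + d\<^sup>2)) (1 / (c\<^sup>2 + d\<^sup>2))"
  using assms
  by (simp add: mobius_act_mat2 complex_eq_iff Re_divide Im_divide)
     (simp add: algebra_simps)

section \<open>Parametrized geodesics\<close>

lemma geodesic_param_mult_diag2:
  "geodesic_param (g ** diag2 s) t = geodesic_param g (s * t)"
  by (simp add: geodesic_param_def diag2_def flip: matrix_mul_assoc)

lemma diag2_in_SL2R: "s \<noteq> 0 \<Longrightarrow> diag2 s \<in> SL2R"
  by (simp add: diag2_def)

lemma geodesic_param_mult:
  assumes "h \<in> SL2R" "s > 0"
  shows "geodesic_param (g ** h) s = mobius_act g (geodesic_param h s)"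
  using assms mobius_act_mult[of "h ** diag2 s" \<i> g]
  by (simp add: geodesic_param_def SL2R_mult diag2_in_SL2R flip: matrix_mul_assoc)

lemma act_geodesic_of:
  assumes "h \<in> SL2R"
  shows "act_geodesic g (geodesic_of h) = geodesic_of (g ** h)"
proof -
  have image: "geodesic_of g = (\<lambda>(s, t). (geodesic_param g s, geodesic_param g t)) ` {(s, t). 0 < s \<and> s \<le> t}" for g
    unfolding geodesic_of_def by force
  show ?thesis
    unfolding act_geodesic_def image image_image
    by (rule image_cong) (auto simp: geodesic_param_mult[OF assms])
qed

text \<open>Clearing the negative powers of \<open>s\<close> leaves quotients of polynomials, which
  can be compared at single parameters and have readable limits at 0.\<close>

lemma geodesic_param_mat2:
  assumes "a * d - b * c = 1" "s > 0"
  shows "geodesic_param (mat2 a b c d) s =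
    Complex ((a*c* s^4 + b*d) / (c\<^sup>2 * s^4 + d\<^sup>2)) (s\<^sup>2 / (c\<^sup>2 * s^4 + d\<^sup>2))"
proof -
  have "geodesic_param (mat2 a b c d) s = mobius_act (mat2 (a* s) (b/s) (c* s) (d/s)) \<i>"
    by (simp add: geodesic_param_def diag2_def divide_inverse)
  also have "\<dots> = Complex ((a* s*(c* s) + b/s*(d/s)) / ((c* s)\<^sup>2 + (d/s)\<^sup>2)) (1 / ((c* s)\<^sup>2 + (d/s)\<^sup>2))"
    using assms by (intro mobius_act_imaginary_unit) (simp add: field_simps)
  also have "(c* s)\<^sup>2 + (d/s)\<^sup>2 = (c\<^sup>2 * s^4 + d\<^sup>2) / s\<^sup>2"
    using assms by (simp add: field_simps power2_eq_square power4_eq_xxxx)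
  also have "a* s*(c* s) + b/s*(d/s) = (a*c* s^4 + b*d) / s\<^sup>2"
    using assms by (simp add: field_simps power2_eq_square power4_eq_xxxx)
  finally show ?thesis using assms(2) by simp
qed

text \<open>
  The triple \<open>(A, B, C)\<close> for which \<open>g diag(1, -1) g\<^sup>-\<^sup>1\<close> has the rows \<open>(B, -C)\<close>
  and \<open>(A, -B)\<close>; the endpoints of the geodesic are then \<open>(B \<plusminus> 1) / A\<close>.
\<close>

definition axis_form :: "real^2^2 \<Rightarrow> real \<times> real \<times> real" where
  "axis_form g = (2 * g$2$1 * g$2$2, g$1$1 * g$2$2 + g$1$2 * g$2$1, 2 * g$1$1 * g$1$2)"

text \<open>The action of the matrix with rows \<open>(p, q)\<close> and \<open>(r, s)\<close> on such triples by conjugation.\<close>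

definition conj_form ::
  "'a \<times> 'a \<times> 'a \<times> 'a \<Rightarrow> 'a \<times> 'a \<times> 'a \<Rightarrow> 'a :: comm_ring_1 \<times> 'a \<times> 'a" where
  "conj_form = (\<lambda>(p, q, r, s) (A, B, C).
     (s\<^sup>2 * A + 2 * r * s * B + r\<^sup>2 * C,
      q * s * A + (p * s + q * r) * B + p * r * C,
      q\<^sup>2 * A + 2 * p * q * B + p\<^sup>2 * C))"

text \<open>Conjugation is written with the adjugate in place of the inverse, so this is a
  polynomial identity without any determinant condition.\<close>

lemma axis_form_mult:
  "axis_form (mat2 p q r s ** g) = conj_form (p, q, r, s) (axis_form g)"
  by (cases g rule: mat2_cases)
     (simp add: axis_form_def conj_form_def algebra_simps power2_eq_square)

text \<open>Diagonal matrices commute with \<open>diag(1, -1)\<close>.\<close>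

lemma axis_form_mult_diag2: "s \<noteq> 0 \<Longrightarrow> axis_form (g ** diag2 s) = axis_form g"
  by (cases g rule: mat2_cases) (simp add: axis_form_def diag2_def field_simps)

lemma axis_form_uminus: "axis_form (- g) = axis_form g"
  by (simp add: axis_form_def)

lemma geodesic_of_mult_diag2:
  assumes "s > 0"
  shows "geodesic_of (g ** diag2 s) = geodesic_of g"
proof (rule set_eqI)
  fix z
  have "z \<in> geodesic_of (g ** diag2 s) \<longleftrightarrow>
      (\<exists>u v. 0 < u \<and> u \<le> v \<and> z = (geodesic_param g (s * u), geodesic_param g (s * v)))"
    unfolding geodesic_of_def geodesic_param_mult_diag2 by blast
  also have "\<dots> \<longleftrightarrow> (\<exists>u v. 0 < u \<and> u \<le> v \<and> z = (geodesic_param g u, geodesic_param g v))"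
  proof safe
    fix u v :: real assume "0 < u" "u \<le> v"
    with assms show "\<exists>u' v'. 0 < u' \<and> u' \<le> v' \<and>
        (geodesic_param g (s * u), geodesic_param g (s * v)) = (geodesic_param g u', geodesic_param g v')"
      by (intro exI[of _ "s * u"] exI[of _ "s * v"]) simp
  next
    fix u v :: real assume "0 < u" "u \<le> v"
    with assms show "\<exists>u' v'. 0 < u' \<and> u' \<le> v' \<and>
        (geodesic_param g u, geodesic_param g v) = (geodesic_param g (s * u'), geodesic_param g (s * v'))"
      by (intro exI[of _ "u / s"] exI[of _ "v / s"]) (simp add: divide_right_mono)
  qed
  also have "\<dots> \<longleftrightarrow> z \<in> geodesic_of g" unfolding geodesic_of_def by blast
  finally show "z \<in> geodesic_of (g ** diag2 s) \<longleftrightarrow> z \<in> geodesic_of g" .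
qed

lemma geodesic_of_uminus: "geodesic_of (- g) = geodesic_of g"
  by (simp add: geodesic_of_def geodesic_param_def mobius_act_uminus)

section \<open>The axis form as a complete invariant\<close>

lemma eq_diag2_if_off_diagonal_zero:
  assumes "a * d = 1"
  shows "\<exists>s>0. mat2 a 0 0 d = diag2 s \<or> mat2 a 0 0 d = - diag2 s"
proof -
  have "a \<noteq> 0" using assms by auto
  hence d: "d = inverse a" using assms by (simp add: field_simps)
  show ?thesis
  proof (cases "a > 0")
    case True thus ?thesis by (auto simp: diag2_def d)
  next
    case False thus ?thesis using \<open>a \<noteq> 0\<close> by (intro exI[of _ "-a"]) (auto simp: diag2_def d)
  qed
qed

text \<open>A matrix of determinant one that commutes with \<open>diag(1, -1)\<close> is
  diagonal.\<close>

lemma axis_form_eq_one: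
  assumes "k \<in> SL2R" "axis_form k = axis_form (mat 1)"
  shows "\<exists>s>0. k = diag2 s \<or> k = - diag2 s"
proof -
  obtain a b c d where k: "k = mat2 a b c d" by (rule mat2_cases)
  have eqs: "c * d = 0" "a * d + b * c = 1" "a * b = 0" "a * d - b * c = 1"
    using assms by (auto simp: k axis_form_def mat_1_eq_mat2)
  hence "a * d = 1" by linarith
  hence "c = 0" "b = 0" using eqs by auto
  thus ?thesis using eq_diag2_if_off_diagonal_zero[OF \<open>a * d = 1\<close>] by (simp add: k)
qed

text \<open>If \<open>k\<close> maps the imaginary axis to itself, then
  \<open>a * c = b * d = 0\<close>, so \<open>k\<close> is diagonal or antidiagonal. An antidiagonal
  matrix reverses the direction, and the order recorded in \<open>geodesic_of\<close> rules it
  out.\<close>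

lemma geodesic_of_eq_one:
  assumes "k \<in> SL2R" "geodesic_of k = geodesic_of (mat 1)"
  shows "\<exists>s>0. k = diag2 s \<or> k = - diag2 s"
proof -
  obtain a b c d where k: "k = mat2 a b c d" by (rule mat2_cases)
  have det: "a * d - b * c = 1" using assms by (simp add: k)
  have one: "geodesic_param (mat 1) s = Complex 0 (s\<^sup>2)" if "s > 0" for s
    using that by (simp add: mat_1_eq_mat2 geodesic_param_mat2)
  have pos: "c\<^sup>2 * s^4 + d\<^sup>2 > 0" if "s > 0" for s
  proof -
    have "c \<noteq> 0 \<or> d \<noteq> 0" using det by auto
    thus ?thesis using that by (auto intro: add_pos_nonneg add_nonneg_pos)
  qed
  have "\<exists>s' t'. 0 < s' \<and> s' \<le> t' \<and> geodesic_param k s = geodesic_param (mat 1) s' \<and>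
      geodesic_param k t = geodesic_param (mat 1) t'" if "0 < s" "s \<le> t" for s t
  proof -
    have "(geodesic_param k s, geodesic_param k t) \<in> geodesic_of k"
      using that unfolding geodesic_of_def by blast
    thus ?thesis unfolding assms(2) unfolding geodesic_of_def by blast
  qed
  hence Re: "Re (geodesic_param k s) = 0" and
    Im: "Im (geodesic_param k s) \<le> Im (geodesic_param k t)" if "0 < s" "s \<le> t" for s t
    using that by (fastforce simp: one)+
  have "a*c* s^4 + b*d = 0" if "s > 0" for s
    using Re[of s s] pos[of s] that by (simp add: k geodesic_param_mat2[OF det])
  \<comment> \<open>Two parameters with different fourth powers separate the two
    coefficients.\<close>
  from this[of 1] this[of 2] have "a * c + b * d = 0" "a * c * 16 + b * d = 0" by simp_all
  hence ac: "a * c = 0" "b * d = 0" by linarith+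
  have "c = 0"
  proof (rule ccontr)
    assume "c \<noteq> 0"
    hence "d = 0" using ac det by auto
    hence Im_eq: "Im (geodesic_param k s) = s\<^sup>2 / (c\<^sup>2 * s^4)" if "s > 0" for s
      using geodesic_param_mat2[OF det that] by (simp add: k)
    \<comment> \<open>With \<open>d = 0\<close> the height is \<open>1 / (c^2 * s^2)\<close>, which
      decreases in \<open>s\<close>, whereas \<open>Im\<close> makes it nondecreasing.\<close>
    have "1 / c\<^sup>2 \<le> 1 / (4 * c\<^sup>2)" using Im[of 1 2] Im_eq[of 1] Im_eq[of 2] by simp
    thus False using \<open>c \<noteq> 0\<close> by (simp add: divide_simps)
  qed
  moreover have "b = 0" using ac det \<open>c = 0\<close> by auto
  ultimately show ?thesis using eq_diag2_if_off_diagonal_zero[of a d] det by (simp add: k)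
qed

lemma SL2R_eq_mult_diag2_if:
  assumes "g \<in> SL2R" "s > 0" "matrix_inv g ** h = diag2 s \<or> matrix_inv g ** h = - diag2 s"
  shows "h = g ** diag2 s \<or> h = - (g ** diag2 s)"
proof -
  have "h = g ** (matrix_inv g ** h)"
    using SL2R_matrix_inv(3)[OF assms(1)] by (simp add: matrix_mul_assoc)
  thus ?thesis using assms(3) by (metis mat2_mult_minus(2))
qed

text \<open>Translation by the inverse of \<open>g\<close> reduces this to the imaginary
  axis.\<close>

lemma geodesic_of_eq_imp_diag2:
  assumes "g \<in> SL2R" "h \<in> SL2R" "geodesic_of g = geodesic_of h"
  shows "\<exists>s>0. h = g ** diag2 s \<or> h = - (g ** diag2 s)"
proof -
  have "geodesic_of (matrix_inv g ** h) = act_geodesic (matrix_inv g) (geodesic_of g)"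
    using assms by (simp add: act_geodesic_of)
  also have "\<dots> = geodesic_of (mat 1)"
    using assms(1) by (simp add: act_geodesic_of SL2R_matrix_inv(2))
  finally obtain s where "s > 0" "matrix_inv g ** h = diag2 s \<or> matrix_inv g ** h = - diag2 s"
    using geodesic_of_eq_one[of "matrix_inv g ** h"] assms SL2R_mult SL2R_matrix_inv(1) by blast
  thus ?thesis using SL2R_eq_mult_diag2_if[OF assms(1)] by blast
qed

lemma axis_form_eq_imp_diag2:
  assumes "g \<in> SL2R" "h \<in> SL2R" "axis_form g = axis_form h"
  shows "\<exists>s>0. h = g ** diag2 s \<or> h = - (g ** diag2 s)"
proof -
  have "axis_form (matrix_inv g ** h) = axis_form (matrix_inv g ** g)"
    using assms(3) by (cases "matrix_inv g" rule: mat2_cases) (simp add: axis_form_mult)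
  hence "axis_form (matrix_inv g ** h) = axis_form (mat 1)"
    using SL2R_matrix_inv(2)[OF assms(1)] by simp
  then obtain s where "s > 0" "matrix_inv g ** h = diag2 s \<or> matrix_inv g ** h = - diag2 s"
    using axis_form_eq_one[of "matrix_inv g ** h"] assms SL2R_mult SL2R_matrix_inv(1) by blast
  thus ?thesis using SL2R_eq_mult_diag2_if[OF assms(1)] by blast
qed

text \<open>Either equality forces \<open>g\<close> and \<open>h\<close> to agree up to sign and a
  positive diagonal factor on the right, and such a change affects neither side. Questions about
  oriented geodesics thus become algebra of triples.\<close>

lemma geodesic_of_eq_iff:
  assumes "g \<in> SL2R" "h \<in> SL2R"
  shows "geodesic_of g = geodesic_of h \<longleftrightarrow> axis_form g = axis_form h"
proof
  assume "geodesic_of g = geodesic_of h"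
  then obtain s where "s > 0" "h = g ** diag2 s \<or> h = - (g ** diag2 s)"
    using geodesic_of_eq_imp_diag2 assms by blast
  thus "axis_form g = axis_form h"
    by (auto simp: axis_form_mult_diag2 axis_form_uminus)
next
  assume "axis_form g = axis_form h"
  then obtain s where "s > 0" "h = g ** diag2 s \<or> h = - (g ** diag2 s)"
    using axis_form_eq_imp_diag2 assms by blast
  thus "geodesic_of g = geodesic_of h"
    by (auto simp: geodesic_of_mult_diag2 geodesic_of_uminus)
qed

lemma Gamma0_subset_SL2R: "Gamma0 n \<subseteq> SL2R"
  by (force simp: Gamma0_def simp flip: of_int_mult of_int_diff)

text \<open>For \<open>c = geodesic_of g\<close>, the condition
  \<open>\<gamma> = \<plusminus> g diag(s, 1/s) g^-1\<close> is the same as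
  \<open>\<gamma> g = \<plusminus> g diag(s, 1/s)\<close>, which says that \<open>\<gamma> g\<close>
  and \<open>g\<close> give the same oriented geodesic.\<close>

lemma geodesic_stabilizer_eq:
  assumes "oriented_geodesic c"
  shows "geodesic_stabilizer n c = {\<gamma> \<in> Gamma0 n. act_geodesic \<gamma> c = c}"
proof (rule set_eqI, rule iffI)
  fix \<gamma> assume *: "\<gamma> \<in> geodesic_stabilizer n c"
  then obtain h s where h: "h \<in> SL2R" "c = geodesic_of h" "s > 0"
    and \<gamma>: "\<gamma> = h ** diag2 s ** matrix_inv h \<or> \<gamma> = - (h ** diag2 s ** matrix_inv h)"
    unfolding geodesic_stabilizer_def by blast
  have "h ** diag2 s ** matrix_inv h ** h = h ** diag2 s"
    using SL2R_matrix_inv(2)[OF h(1)] by (simp flip: matrix_mul_assoc)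
  hence "\<gamma> ** h = h ** diag2 s \<or> \<gamma> ** h = - (h ** diag2 s)"
    using \<gamma> by auto
  hence "geodesic_of (\<gamma> ** h) = geodesic_of h"
    using geodesic_of_mult_diag2[OF h(3)] geodesic_of_uminus by metis
  hence "act_geodesic \<gamma> c = c" by (simp add: h(2) act_geodesic_of[OF h(1)])
  thus "\<gamma> \<in> {\<gamma> \<in> Gamma0 n. act_geodesic \<gamma> c = c}"
    using * by (simp add: geodesic_stabilizer_def)
next
  fix \<gamma> assume "\<gamma> \<in> {\<gamma> \<in> Gamma0 n. act_geodesic \<gamma> c = c}"
  hence \<gamma>: "\<gamma> \<in> Gamma0 n" "act_geodesic \<gamma> c = c" by auto
  obtain g where g: "g \<in> SL2R" "c = geodesic_of g"
    using assms unfolding oriented_geodesic_def by blast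
  have "\<gamma> ** g \<in> SL2R" using \<gamma> g Gamma0_subset_SL2R SL2R_mult by blast
  moreover have "geodesic_of g = geodesic_of (\<gamma> ** g)"
    using \<gamma>(2) unfolding g(2) act_geodesic_of[OF g(1)] by (rule sym)
  ultimately obtain s where s: "s > 0" "\<gamma> ** g = g ** diag2 s \<or> \<gamma> ** g = - (g ** diag2 s)"
    using geodesic_of_eq_imp_diag2 g(1) by blast
  have "\<gamma> = \<gamma> ** g ** matrix_inv g"
    using SL2R_matrix_inv(3)[OF g(1)] by (simp flip: matrix_mul_assoc)
  hence "\<gamma> = g ** diag2 s ** matrix_inv g \<or> \<gamma> = - (g ** diag2 s ** matrix_inv g)"
    using s(2) by (elim disjE) auto
  thus "\<gamma> \<in> geodesic_stabilizer n c"
    unfolding geodesic_stabilizer_def using \<gamma>(1) g s(1) by blast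
qed

section \<open>Endpoints and tops of geodesics\<close>

lemma geodesic_endpoints:
  assumes "a * d - b * c = 1" "c \<noteq> 0" "d \<noteq> 0"
  shows "(geodesic_param (mat2 a b c d) \<longlongrightarrow> of_real (b / d)) (at_right 0)"
    and "(geodesic_param (mat2 a b c d) \<longlongrightarrow> of_real (a / c)) at_top"
proof -
  let ?f = "\<lambda>s. Complex ((a*c* s^4 + b*d) / (c\<^sup>2 * s^4 + d\<^sup>2)) (s\<^sup>2 / (c\<^sup>2 * s^4 + d\<^sup>2))"
  have "((\<lambda>s. (a*c* s^4 + b*d) / (c\<^sup>2 * s^4 + d\<^sup>2)) \<longlongrightarrow> (a*c*0^4 + b*d) / (c\<^sup>2*0^4 + d\<^sup>2)) (at_right 0)"
    using assms by (intro tendsto_intros) auto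
  moreover have "((\<lambda>s. s\<^sup>2 / (c\<^sup>2 * s^4 + d\<^sup>2)) \<longlongrightarrow> 0\<^sup>2 / (c\<^sup>2*0^4 + d\<^sup>2)) (at_right 0)"
    using assms by (intro tendsto_intros) auto
  ultimately have "(?f \<longlongrightarrow> of_real (b / d)) (at_right 0)"
    using assms by (auto simp: tendsto_complex_iff power2_eq_square)
  moreover have "\<forall>\<^sub>F s in at_right 0. ?f s = geodesic_param (mat2 a b c d) s"
    using geodesic_param_mat2[OF assms(1)] by (simp add: eventually_at_right_less eventually_at_filter)
  ultimately show "(geodesic_param (mat2 a b c d) \<longlongrightarrow> of_real (b / d)) (at_right 0)"
    by (rule Lim_transform_eventually)
  have inv: "((\<lambda>s::real. inverse s ^ k) \<longlongrightarrow> 0) at_top" if "k > 0" for k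
    using that tendsto_power[OF tendsto_inverse_0_at_top[OF filterlim_ident], of k]
    by (simp add: power_0_left del: tendsto_power_zero)
  \<comment> \<open>Numerators and denominators are divided by \<open>s^4\<close>, so that the limit
    at infinity becomes one in \<open>inverse s\<close> at 0.\<close>
  let ?h = "\<lambda>s. Complex ((a*c + b*d* inverse s^4) / (c\<^sup>2 + d\<^sup>2* inverse s^4))
      (inverse s^2 / (c\<^sup>2 + d\<^sup>2* inverse s^4))"
  have "((\<lambda>s. (a*c + b*d* inverse s^4) / (c\<^sup>2 + d\<^sup>2* inverse s^4)) \<longlongrightarrow> (a*c + b*d*0) / (c\<^sup>2 + d\<^sup>2*0)) at_top"
    using assms by (intro tendsto_intros inv) auto
  moreover have "((\<lambda>s. inverse s^2 / (c\<^sup>2 + d\<^sup>2* inverse s^4)) \<longlongrightarrow> 0 / (c\<^sup>2 + d\<^sup>2*0)) at_top"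
    using assms by (intro tendsto_intros inv) auto
  ultimately have "(?h \<longlongrightarrow> of_real (a / c)) at_top"
    using assms by (auto simp: tendsto_complex_iff power2_eq_square)
  moreover have "?h s = geodesic_param (mat2 a b c d) s" if "s > 0" for s
  proof -
    have cancel: "(x / s^4) / (y / s^4) = x / y" for x y
      using that by simp
    have "c\<^sup>2 + d\<^sup>2* inverse s^4 = (c\<^sup>2 * s^4 + d\<^sup>2) / s^4"
      "a*c + b*d* inverse s^4 = (a*c* s^4 + b*d) / s^4" "inverse s^2 = s\<^sup>2 / s^4"
      using that by (simp_all add: field_simps power2_eq_square power4_eq_xxxx)
    thus ?thesis using geodesic_param_mat2[OF assms(1) that] by (simp only: cancel)
  qed
  hence "\<forall>\<^sub>F s in at_top. ?h s = geodesic_param (mat2 a b c d) s"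
    by (rule eventually_mono[OF eventually_gt_at_top[of 0]])
  ultimately show "(geodesic_param (mat2 a b c d) \<longlongrightarrow> of_real (a / c)) at_top"
    by (rule Lim_transform_eventually)
qed

text \<open>All matrices \<open>h\<close> that represent the geodesic share the axis form of
  \<open>g\<close>. Since \<open>a * d - b * c = 1\<close>, the numbers \<open>B - 1\<close> and
  \<open>B + 1\<close> are \<open>2 * b * c\<close> and \<open>2 * a * d\<close>, so the quotients
  are the limits \<open>b / d\<close> and \<open>a / c\<close>, whichever \<open>h\<close> is
  used.\<close>

lemma endpoints_eq:
  assumes g: "g \<in> SL2R" "axis_form g = (A, B, C)" "A \<noteq> 0"
  shows "backward_endpoint (geodesic_of g) x \<longleftrightarrow> x = (B - 1) / A"
    and "forward_endpoint (geodesic_of g) x \<longleftrightarrow> x = (B + 1) / A"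
proof -
  have lims: "(geodesic_param h \<longlongrightarrow> of_real ((B - 1) / A)) (at_right 0) \<and>
      (geodesic_param h \<longlongrightarrow> of_real ((B + 1) / A)) at_top"
    if h: "h \<in> SL2R" "geodesic_of g = geodesic_of h" for h
  proof -
    obtain a b c d where abcd: "h = mat2 a b c d" by (rule mat2_cases)
    have det: "a * d - b * c = 1" using h by (simp add: abcd)
    have "axis_form h = (A, B, C)" using g h geodesic_of_eq_iff by metis
    hence A: "A = 2 * c * d" and B: "B = a * d + b * c" by (auto simp: axis_form_def abcd)
    have nz: "c \<noteq> 0" "d \<noteq> 0" using g(3) A by auto
    have "(B - 1) / A = b / d" "(B + 1) / A = a / c"
      using nz unfolding A B det[symmetric] by (simp_all add: field_simps)
    thus ?thesis using geodesic_endpoints[OF det nz] abcd by simp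
  qed
  show "backward_endpoint (geodesic_of g) x \<longleftrightarrow> x = (B - 1) / A"
    unfolding backward_endpoint_def using lims g(1)
    by (metis of_real_eq_iff tendsto_unique trivial_limit_at_right_real)
  show "forward_endpoint (geodesic_of g) x \<longleftrightarrow> x = (B + 1) / A"
    unfolding forward_endpoint_def using lims g(1)
    by (metis of_real_eq_iff tendsto_unique trivial_limit_at_top_linorder)
qed

lemma positively_oriented_iff:
  assumes "g \<in> SL2R" "axis_form g = (A, B, C)" "A \<noteq> 0"
  shows "positively_oriented (geodesic_of g) \<longleftrightarrow> A > 0"
proof -
  have "(B + 1) / A - (B - 1) / A = 2 / A" by (simp flip: diff_divide_distrib)
  hence "(B - 1) / A < (B + 1) / A \<longleftrightarrow> 2 / A > 0" by linarith
  thus ?thesis by (auto simp: positively_oriented_def endpoints_eq[OF assms] zero_less_divide_iff)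
qed

lemma Field_geodesic_of: "Field (geodesic_of g) = geodesic_param g ` {0<..}"
  unfolding geodesic_of_def Field_def by (force simp: Domain_iff Range_iff)

text \<open>The geodesic is a semicircle of radius \<open>1 / A\<close>. Completing the square
  writes the denominator of the height as \<open>A * s^2 + (c * s^2 - d)^2\<close>, so the height is
  at most \<open>1 / A\<close>, with equality exactly when \<open>c * s^2 = d\<close>.\<close>

lemma geodesic_top_eq:
  assumes g: "g \<in> SL2R" "axis_form g = (A, B, C)" "A > 0"
  shows "geodesic_top (geodesic_of g) = Complex (B / A) (1 / A)"
proof -
  obtain a b c d where abcd: "g = mat2 a b c d" by (rule mat2_cases)
  have det: "a * d - b * c = 1" using g by (simp add: abcd)
  have A: "A = 2 * c * d" and B: "B = a * d + b * c" using g by (auto simp: axis_form_def abcd)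
  have cd: "c * d > 0" using g(3) A by simp
  hence nz: "c \<noteq> 0" "d \<noteq> 0" by auto
  have param: "geodesic_param g s =
      Complex ((a*c* s^4 + b*d) / (c\<^sup>2 * s^4 + d\<^sup>2)) (s\<^sup>2 / (c\<^sup>2 * s^4 + d\<^sup>2))" if "s > 0" for s
    using geodesic_param_mat2[OF det that] by (simp add: abcd)
  have pos: "c\<^sup>2 * s^4 + d\<^sup>2 > 0" for s using nz by (simp add: add_nonneg_pos)
  have sq: "c\<^sup>2 * s^4 + d\<^sup>2 = A * s\<^sup>2 + (c* s\<^sup>2 - d)\<^sup>2" for s
    unfolding A by (simp add: power2_eq_square power4_eq_xxxx algebra_simps)
  have le: "Im (geodesic_param g s) \<le> 1 / A" if "s > 0" for s
    using that pos[of s] sq[of s] g(3) by (simp add: param field_simps)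
  have top: "geodesic_param g s = Complex (B / A) (1 / A)"
    if "s > 0" "c * s\<^sup>2 = d" for s
  proof -
    have s2: "s\<^sup>2 = d / c" using that nz by (simp add: field_simps)
    hence "s^4 = d\<^sup>2 / c\<^sup>2" by (metis power_divide power_even_eq numeral_Bit0 mult_2)
    thus ?thesis using that nz
      by (simp add: param s2 A B field_simps power2_eq_square)
  qed
  have unique: "c * s\<^sup>2 = d" if "s > 0" "Im (geodesic_param g s) = 1 / A" for s
    using that pos[of s] sq[of s] g(3) by (simp add: param field_simps)
  \<comment> \<open>The root exists because \<open>A = 2 * c * d > 0\<close> gives \<open>c\<close>
    and \<open>d\<close> the same sign.\<close>
  define s0 where "s0 = sqrt (d / c)"
  have "d / c > 0" using cd by (auto simp: zero_less_mult_iff zero_less_divide_iff)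
  hence s0: "s0 > 0" "c * s0\<^sup>2 = d" using nz by (simp_all add: s0_def)
  \<comment> \<open>\<open>arg_max_on\<close> is a choice among the maximizers, so its value is
    known only once the maximizer is shown to be unique.\<close>
  have "is_arg_max Im (\<lambda>z. z \<in> Field (geodesic_of g)) z \<longleftrightarrow> z = Complex (B / A) (1 / A)" for z
  proof
    assume *: "is_arg_max Im (\<lambda>z. z \<in> Field (geodesic_of g)) z"
    then obtain s where s: "s > 0" "z = geodesic_param g s"
      by (auto simp: is_arg_max_def Field_geodesic_of)
    have "\<not> Im (geodesic_param g s0) > Im z"
      using * s0 by (auto simp: is_arg_max_def Field_geodesic_of)
    hence "Im z = 1 / A" using le[OF s(1)] s top[OF s0] by simp
    thus "z = Complex (B / A) (1 / A)" using unique s top by blast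
  next
    assume z: "z = Complex (B / A) (1 / A)"
    hence "z \<in> Field (geodesic_of g)" using top[OF s0] s0
      by (auto simp: Field_geodesic_of intro!: image_eqI[of _ _ s0])
    thus "is_arg_max Im (\<lambda>z. z \<in> Field (geodesic_of g)) z"
      using le z by (fastforce simp: is_arg_max_def Field_geodesic_of)
  qed
  thus ?thesis by (simp add: geodesic_top_def arg_max_on_def arg_max_def)
qed

section \<open>Integral forms under conjugation\<close>

type_synonym int_mat2 = "int \<times> int \<times> int \<times> int"

fun int_mat2_mult :: "int_mat2 \<Rightarrow> int_mat2 \<Rightarrow> int_mat2" where
  "int_mat2_mult (p, q, r, s) (p', q', r', s') =
     (p * p' + q * r', p * q' + q * s', r * p' + s * r', r * q' + s * s')"

fun int_mat2_adjugate :: "int_mat2 \<Rightarrow> int_mat2" where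
  "int_mat2_adjugate (p, q, r, s) = (s, - q, - r, p)"

fun real_mat2 :: "int_mat2 \<Rightarrow> real^2^2" where
  "real_mat2 (p, q, r, s) = mat2 (of_int p) (of_int q) (of_int r) (of_int s)"

definition int_Gamma0 :: "int \<Rightarrow> int_mat2 set" where
  "int_Gamma0 n = {(p, q, r, s). p * s - q * r = 1 \<and> n dvd r}"

lemma Gamma0_eq_image: "Gamma0 n = real_mat2 ` int_Gamma0 n"
  by (force simp: Gamma0_def int_Gamma0_def cong_0_iff image_iff)

lemma real_mat2_mult: "real_mat2 (int_mat2_mult x y) = real_mat2 x ** real_mat2 y"
  by (cases x; cases y) simp

lemma int_Gamma0_mult:
  assumes "x \<in> int_Gamma0 n" "y \<in> int_Gamma0 n"
  shows "int_mat2_mult x y \<in> int_Gamma0 n"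
proof -
  obtain p q r s where x: "x = (p, q, r, s)" by (cases x)
  obtain p' q' r' s' where y: "y = (p', q', r', s')" by (cases y)
  have "(p * p' + q * r') * (r * q' + s * s') - (p * q' + q * s') * (r * p' + s * r') =
      (p * s - q * r) * (p' * s' - q' * r')"
    by (simp add: algebra_simps)
  thus ?thesis using assms by (simp add: x y int_Gamma0_def)
qed

lemma int_Gamma0_adjugate: "x \<in> int_Gamma0 n \<Longrightarrow> int_mat2_adjugate x \<in> int_Gamma0 n"
  by (cases x) (simp add: int_Gamma0_def algebra_simps)

lemma int_Gamma0_one: "(1, 0, 0, 1) \<in> int_Gamma0 n"
  by (simp add: int_Gamma0_def)

lemma int_mat2_adjugate_mult:
  assumes "x \<in> int_Gamma0 n"
  shows "int_mat2_mult (int_mat2_adjugate x) x = (1, 0, 0, 1)"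
    and "int_mat2_mult x (int_mat2_adjugate x) = (1, 0, 0, 1)"
  using assms by (cases x; simp add: int_Gamma0_def algebra_simps)+

lemma conj_form_mult:
  "conj_form (int_mat2_mult x y) Q = conj_form x (conj_form y Q)"
proof -
  obtain p q r s where x: "x = (p, q, r, s)" by (cases x)
  obtain p' q' r' s' where y: "y = (p', q', r', s')" by (cases y)
  obtain A B C where Q: "Q = (A, B, C)" by (cases Q)
  show ?thesis unfolding x y Q conj_form_def
    by (simp add: algebra_simps power2_eq_square)
qed

lemma conj_form_one [simp]: "conj_form (1, 0, 0, 1) Q = Q"
  by (cases Q) (simp add: conj_form_def)

lemma conj_form_adjugate:
  assumes "x \<in> int_Gamma0 n"
  shows "conj_form (int_mat2_adjugate x) (conj_form x Q) = Q"
    and "conj_form x (conj_form (int_mat2_adjugate x) Q) = Q"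
  using int_mat2_adjugate_mult[OF assms] by (simp_all flip: conj_form_mult)

text \<open>A quarter of the usual discriminant of the binary form
  \<open>A x^2 + 2 B x y + C y^2\<close>.\<close>

fun form_disc :: "int \<times> int \<times> int \<Rightarrow> int" where
  "form_disc (A, B, C) = B\<^sup>2 - A * C"

lemma form_disc_conj_form:
  assumes "x \<in> int_Gamma0 n"
  shows "form_disc (conj_form x Q) = form_disc Q"
proof -
  obtain p q r s where x: "x = (p, q, r, s)" by (cases x)
  obtain A B C where Q: "Q = (A, B, C)" by (cases Q)
  have "form_disc (conj_form x Q) = (p * s - q * r)\<^sup>2 * (B\<^sup>2 - A * C)"
    unfolding x Q conj_form_def by (simp add: algebra_simps power2_eq_square)
  thus ?thesis using assms by (simp add: x Q int_Gamma0_def)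
qed

text \<open>The sign of \<open>A\<close> is left free because conjugation by
  \<open>int_Gamma0 n\<close> can change it. Positive orientation selects \<open>A > 0\<close>
  later.\<close>

definition root_forms :: "int \<Rightarrow> int \<Rightarrow> int \<Rightarrow> (int \<times> int \<times> int) set" where
  "root_forms D n \<nu> = {(A, B, C). B\<^sup>2 - A * C = D \<and> n dvd A \<and> [B = \<nu>] (mod n)}"

text \<open>Modulo \<open>n\<close> both \<open>A\<close> and \<open>r\<close> vanish, hence so does
  \<open>A'\<close>. Moreover \<open>p * s\<close> is congruent to 1, so \<open>B'\<close> is
  congruent to \<open>B\<close>.\<close>

lemma conj_form_in_root_forms:
  assumes "x \<in> int_Gamma0 n" "Q \<in> root_forms D n \<nu>"
  shows "conj_form x Q \<in> root_forms D n \<nu>"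
proof -
  obtain p q r s where x: "x = (p, q, r, s)" by (cases x)
  obtain A B C where Q: "Q = (A, B, C)" by (cases Q)
  obtain A' B' C' where Q': "conj_form x Q = (A', B', C')" by (cases "conj_form x Q")
  have "B'\<^sup>2 - A' * C' = D"
    using form_disc_conj_form[OF assms(1), of Q, unfolded Q'] assms(2) by (simp add: Q root_forms_def)
  moreover have A': "A' = s\<^sup>2 * A + 2 * r * s * B + r\<^sup>2 * C"
    and B': "B' = q * s * A + (p * s + q * r) * B + p * r * C"
    using Q' by (auto simp: x Q conj_form_def)
  have dvd: "n dvd A" "n dvd r" "p * s - q * r = 1" and B: "[B = \<nu>] (mod n)"
    using assms by (auto simp: x Q int_Gamma0_def root_forms_def)
  have "n dvd A'" unfolding A' using dvd by (simp add: power2_eq_square)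
  moreover have "B' - B = q * s * A + 2 * q * B * r + p * C * r + (p * s - q * r - 1) * B"
    unfolding B' by (simp add: algebra_simps)
  hence "n dvd B' - B" using dvd by simp
  hence "[B' = \<nu>] (mod n)" using B by (meson cong_iff_dvd_diff cong_trans)
  ultimately show ?thesis by (simp add: Q' root_forms_def)
qed

section \<open>Reduction theory and finiteness of orbits\<close>

text \<open>This is the balanced residue of \<open>B\<close> modulo \<open>A\<close>: a remainder
  above half of \<open>\<bar>A\<bar>\<close> is lowered by \<open>\<bar>A\<bar>\<close>.\<close>

lemma ex_small_residue:
  fixes A B :: int
  assumes "A \<noteq> 0"
  shows "\<exists>k. 2 * \<bar>k * A + B\<bar> \<le> \<bar>A\<bar>"
proof -
  define r where "r = B mod \<bar>A\<bar>"
  have "B = \<bar>A\<bar> * (B div \<bar>A\<bar>) + r" by (simp add: r_def)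
  hence "r - B = \<bar>A\<bar> * - (B div \<bar>A\<bar>)" by simp
  hence "\<bar>A\<bar> dvd r - B" by (rule dvdI)
  hence r: "0 \<le> r" "r < \<bar>A\<bar>" "A dvd r - B"
    using assms by (simp_all add: r_def)
  define b where "b = (if 2 * r \<le> \<bar>A\<bar> then r else r - \<bar>A\<bar>)"
  have "A dvd (r - B) - \<bar>A\<bar>" by (rule dvd_diff[OF r(3)]) simp
  hence "A dvd b - B" using r(3) by (simp add: b_def algebra_simps)
  then obtain k where "b - B = A * k" by blast
  hence "k * A + B = b" by (simp add: algebra_simps)
  thus ?thesis using r by (intro exI[of _ k]) (auto simp: b_def)
qed

text \<open>Gauss reduction by descent on \<open>\<bar>A\<bar>\<close>. A translation makes the
  middle coefficient at most \<open>\<bar>A\<bar> / 2\<close> in absolute value. If the last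
  coefficient is then smaller than \<open>A\<close>, the two are exchanged and the argument repeats;
  otherwise the discriminant bounds all coefficients. As \<open>D\<close> is not a square,
  \<open>A\<close> never becomes 0.\<close>

lemma form_reduction:
  assumes "D > 0" "\<And>x. x\<^sup>2 \<noteq> D" "form_disc Q = D"
  shows "\<exists>x\<in>int_Gamma0 1. conj_form x Q \<in> {-3*D..3*D} \<times> {-3*D..3*D} \<times> {-3*D..3*D}"
  using assms(3)
proof (induction "nat \<bar>fst Q\<bar>" arbitrary: Q rule: less_induct)
  case less
  obtain A B C where Q: "Q = (A, B, C)" by (cases Q)
  have D: "B\<^sup>2 - A * C = D" using less.prems by (simp add: Q)
  hence A: "A \<noteq> 0" using assms(2)[of B] by auto
  then obtain k where k: "2 * \<bar>k * A + B\<bar> \<le> \<bar>A\<bar>" using ex_small_residue by blast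
  define T where "T = (1::int, k, 0::int, 1::int)"
  have T: "T \<in> int_Gamma0 1" by (simp add: T_def int_Gamma0_def)
  define B' C' where "B' = k * A + B" and "C' = k\<^sup>2 * A + 2 * k * B + C"
  have TQ: "conj_form T Q = (A, B', C')"
    by (simp add: T_def Q conj_form_def B'_def C'_def)
  have D': "B'\<^sup>2 - A * C' = D"
    using form_disc_conj_form[OF T, of Q] less.prems by (simp add: TQ)
  hence C': "C' \<noteq> 0" using assms(2)[of B'] by auto
  show ?case
  proof (cases "\<bar>C'\<bar> < \<bar>A\<bar>")
    case True
    \<comment> \<open>The inversion \<open>z \<mapsto> -1/z\<close> exchanges the outer
      coefficients.\<close>
    define S where "S = (0::int, -1::int, 1::int, 0::int)"
    have S: "S \<in> int_Gamma0 1" by (simp add: S_def int_Gamma0_def)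
    have SQ: "conj_form S (A, B', C') = (C', - B', A)" by (simp add: S_def conj_form_def)
    have disc: "form_disc (C', - B', A) = D" using D' by (simp add: algebra_simps)
    have "nat \<bar>fst (C', - B', A)\<bar> < nat \<bar>fst Q\<bar>" using True by (simp add: Q)
    from less.hyps[OF this disc] obtain x where x: "x \<in> int_Gamma0 1"
      "conj_form x (C', - B', A) \<in> {-3*D..3*D} \<times> {-3*D..3*D} \<times> {-3*D..3*D}"
      by (elim bexE)
    have "conj_form (int_mat2_mult x (int_mat2_mult S T)) Q = conj_form x (C', - B', A)"
      by (simp add: conj_form_mult TQ SQ)
    hence "conj_form (int_mat2_mult x (int_mat2_mult S T)) Q
        \<in> {-3*D..3*D} \<times> {-3*D..3*D} \<times> {-3*D..3*D}"
      using x(2) by (simp only:)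
    moreover have "int_mat2_mult x (int_mat2_mult S T) \<in> int_Gamma0 1"
      by (intro int_Gamma0_mult x(1) S T)
    ultimately show ?thesis by (rule bexI)
  next
    case False
    have "(2 * \<bar>B'\<bar>)\<^sup>2 \<le> \<bar>A\<bar>\<^sup>2" using k by (intro power_mono) (auto simp: B'_def)
    hence B2: "4 * B'\<^sup>2 \<le> A\<^sup>2" by (simp add: power_mult_distrib)
    have AC: "\<bar>A\<bar> * \<bar>C'\<bar> \<le> B'\<^sup>2 + D"
    proof -
      have "\<bar>A\<bar> * \<bar>C'\<bar> = \<bar>B'\<^sup>2 - D\<bar>" using D' by (simp flip: abs_mult)
      thus ?thesis using assms(1) zero_le_power2[of B'] by linarith
    qed
    \<comment> \<open>Together, \<open>A^2 \<le> \<bar>A\<bar> * \<bar>C'\<bar> \<le> B'^2 + D \<le>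
      A^2 / 4 + D\<close>. This bounds \<open>A^2\<close> by \<open>4 * D / 3\<close>, so the box of
      side \<open>3 * D\<close> is generous.\<close>
    have "A\<^sup>2 \<le> \<bar>A\<bar> * \<bar>C'\<bar>"
      using mult_left_mono[of "\<bar>A\<bar>" "\<bar>C'\<bar>" "\<bar>A\<bar>"] False by (simp add: power2_eq_square)
    hence A2: "3 * A\<^sup>2 \<le> 4 * D" using AC B2 by linarith
    have "\<bar>A\<bar> * 1 \<le> \<bar>A\<bar> * \<bar>A\<bar>" using A by (intro mult_left_mono) auto
    hence "\<bar>A\<bar> \<le> A\<^sup>2" by (simp add: power2_eq_square)
    hence "\<bar>A\<bar> \<le> 3 * D" using A2 assms(1) by linarith
    moreover have "2 * \<bar>B'\<bar> \<le> \<bar>A\<bar>" using k by (simp only: B'_def)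
    hence "\<bar>B'\<bar> \<le> 3 * D" using calculation by simp
    moreover have "1 * \<bar>C'\<bar> \<le> \<bar>A\<bar> * \<bar>C'\<bar>" using A by (intro mult_right_mono) auto
    hence "\<bar>C'\<bar> \<le> 3 * D" using AC A2 B2 assms(1) zero_le_power2[of B'] by linarith
    ultimately have "conj_form T Q \<in> {-3*D..3*D} \<times> {-3*D..3*D} \<times> {-3*D..3*D}"
      by (auto simp: TQ)
    thus ?thesis using T by (rule bexI)
  qed
qed

definition form_orbit :: "int \<Rightarrow> int \<times> int \<times> int \<Rightarrow> (int \<times> int \<times> int) set" where
  "form_orbit n Q = (\<lambda>x. conj_form x Q) ` int_Gamma0 n"

lemma form_orbit_conj_form:
  assumes "x \<in> int_Gamma0 n"
  shows "form_orbit n (conj_form x Q) = form_orbit n Q"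
proof -
  have sub: "form_orbit n (conj_form y R) \<subseteq> form_orbit n R" if "y \<in> int_Gamma0 n" for y R
    unfolding form_orbit_def conj_form_mult[symmetric] using int_Gamma0_mult[OF _ that] by blast
  have "form_orbit n Q \<subseteq> form_orbit n (conj_form x Q)"
    using sub[OF int_Gamma0_adjugate[OF assms], of "conj_form x Q"]
    by (simp add: conj_form_adjugate[OF assms])
  thus ?thesis using sub[OF assms] by blast
qed

lemma self_in_form_orbit: "Q \<in> form_orbit n Q"
  unfolding form_orbit_def using int_Gamma0_one by (metis conj_form_one image_eqI)

text \<open>
  A form is determined up to \<open>int_Gamma0 n\<close> by a reduced form in its \<open>SL\<^sub>2(\<int>)\<close>-orbit together
  with the class modulo \<open>n\<close> of the reducing matrix.
\<close>

lemma finite_form_orbits: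
  assumes "D > 0" "\<And>x. x\<^sup>2 \<noteq> D" "n > 0"
  shows "finite (form_orbit n ` {Q. form_disc Q = D})"
proof -
  define F where "F = {Q. form_disc Q = D}"
  define K where "K = {-3*D..3*D} \<times> {-3*D..3*D} \<times> {-3*D..3*D}"
  have "\<exists>x\<in>int_Gamma0 1. conj_form x Q \<in> K" if "Q \<in> F" for Q
    using form_reduction[OF assms(1,2), of Q] that by (simp only: K_def F_def mem_Collect_eq)
  hence "\<forall>Q\<in>F. \<exists>x. x \<in> int_Gamma0 1 \<and> conj_form x Q \<in> K" by blast
  from bchoice[OF this] obtain X
    where "\<forall>Q\<in>F. X Q \<in> int_Gamma0 1 \<and> conj_form (X Q) Q \<in> K" by (rule exE)
  hence X: "X Q \<in> int_Gamma0 1" "conj_form (X Q) Q \<in> K" if "Q \<in> F" for Q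
    using that by blast+
  \<comment> \<open>The key is to take finitely many values and still determine the orbit: the box
    bounds its first component, residues its second.\<close>
  define red where "red = (\<lambda>(p, q, r, s). (p mod n, q mod n, r mod n, s mod n))"
  define key where "key Q = (conj_form (X Q) Q, red (X Q))" for Q
  have "red x \<in> {0..<n} \<times> {0..<n} \<times> {0..<n} \<times> {0..<n}" for x
    using assms(3) by (cases x) (simp add: red_def)
  hence "key ` F \<subseteq> K \<times> ({0..<n} \<times> {0..<n} \<times> {0..<n} \<times> {0..<n})"
    using X(2) unfolding key_def by (intro image_subsetI SigmaI)
  hence fin: "finite (key ` F)" by (rule finite_subset) (simp add: K_def)
  have same: "form_orbit n Q = form_orbit n R" if "Q \<in> F" "R \<in> F" "key Q = key R" for Q R
  proof -
    define z where "z = int_mat2_mult (int_mat2_adjugate (X R)) (X Q)"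
    obtain p q r s where x: "X Q = (p, q, r, s)" by (cases "X Q")
    obtain p' q' r' s' where y: "X R = (p', q', r', s')" by (cases "X R")
    have "[p = p'] (mod n)" "[r = r'] (mod n)"
      using that(3) by (auto simp: key_def red_def x y cong_def)
    \<comment> \<open>\<open>p' * r - r' * p\<close> is the lower left entry of \<open>z\<close>,
      the quotient of the two reducing matrices. That \<open>n\<close> divides it is what lifts
      \<open>z\<close> from level 1 to level \<open>n\<close>.\<close>
    hence "[p' * r - r' * p = p * r - r * p] (mod n)"
      by (intro cong_diff cong_mult) (auto simp: cong_sym)
    hence "n dvd p' * r - r' * p" by (simp add: cong_0_iff)
    moreover have "z \<in> int_Gamma0 1"
      unfolding z_def using X(1) that int_Gamma0_mult int_Gamma0_adjugate by blast
    ultimately have "z \<in> int_Gamma0 n"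
      by (simp add: z_def x y int_Gamma0_def mult.commute)
    moreover have "conj_form z Q = R"
      using that(3) conj_form_adjugate(1)[OF X(1)[OF that(2)], of R]
      by (simp add: z_def conj_form_mult key_def)
    ultimately show ?thesis using form_orbit_conj_form[of z n Q] by simp
  qed
  \<comment> \<open>The orbit is a function of the key, so there are at most as many orbits as
    keys.\<close>
  have "form_orbit n Q = form_orbit n (inv_into F key (key Q))" if "Q \<in> F" for Q
  proof (rule same[OF that])
    have "key Q \<in> key ` F" using that by (rule imageI)
    thus "inv_into F key (key Q) \<in> F" "key Q = key (inv_into F key (key Q))"
      by (rule inv_into_into, rule f_inv_into_f[symmetric])
  qed
  hence "form_orbit n ` F = (\<lambda>k. form_orbit n (inv_into F key k)) ` key ` F"
    unfolding image_image by (rule image_cong[OF refl])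
  thus ?thesis using fin by (simp add: F_def)
qed

text \<open>One form is chosen from each orbit. The choice depends only on the orbit as a set, so
  two equivalent representatives are equal; invariance of \<open>root_forms\<close> keeps the
  representatives inside it.\<close>

lemma ex_finite_form_representatives:
  assumes "D > 0" "\<And>x. x\<^sup>2 \<noteq> D" "n > 0"
  shows "\<exists>Rs. finite Rs \<and> Rs \<subseteq> root_forms D n \<nu> \<and>
    (\<forall>Q\<in>root_forms D n \<nu>. \<exists>R\<in>Rs. \<exists>x\<in>int_Gamma0 n. conj_form x R = Q) \<and>
    (\<forall>R\<in>Rs. \<forall>R'\<in>Rs. \<forall>x\<in>int_Gamma0 n. conj_form x R = R' \<longrightarrow> R = R')"
proof -
  define F where "F = root_forms D n \<nu>"
  define rep where "rep Q = (SOME R. R \<in> form_orbit n Q)" for Q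
  define Rs where "Rs = rep ` F"
  have "F \<subseteq> {Q. form_disc Q = D}" by (auto simp: F_def root_forms_def)
  hence "finite (form_orbit n ` F)"
    by (rule finite_subset[OF image_mono finite_form_orbits[OF assms]])
  moreover have "Rs = (\<lambda>U. SOME R. R \<in> U) ` form_orbit n ` F"
    unfolding Rs_def rep_def image_image ..
  ultimately have "finite Rs" by simp
  have "rep Q \<in> form_orbit n Q" for Q
    unfolding rep_def using self_in_form_orbit by (rule someI)
  hence rep: "\<exists>x\<in>int_Gamma0 n. rep Q = conj_form x Q" for Q
    unfolding form_orbit_def by blast
  have "Rs \<subseteq> F"
  proof
    fix R assume "R \<in> Rs"
    then obtain Q where "Q \<in> F" "R = rep Q" unfolding Rs_def by blast
    moreover obtain x where "x \<in> int_Gamma0 n" "rep Q = conj_form x Q" using rep by blast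
    ultimately show "R \<in> F" using conj_form_in_root_forms[of x n Q D \<nu>] by (simp add: F_def)
  qed
  moreover have "\<exists>R\<in>Rs. \<exists>x\<in>int_Gamma0 n. conj_form x R = Q" if "Q \<in> F" for Q
  proof -
    obtain x where x: "x \<in> int_Gamma0 n" "rep Q = conj_form x Q" using rep by blast
    hence "conj_form (int_mat2_adjugate x) (rep Q) = Q" by (simp add: conj_form_adjugate)
    moreover have "rep Q \<in> Rs" using that by (simp add: Rs_def)
    ultimately show ?thesis using int_Gamma0_adjugate[OF x(1)] by blast
  qed
  moreover have "R = R'" if R: "R \<in> Rs" "R' \<in> Rs" "x \<in> int_Gamma0 n" "conj_form x R = R'" for R R' x
  proof -
    \<comment> \<open>A representative lies in the orbit from which it was chosen, so choosing again
      from its own orbit returns it.\<close>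
    have self_rep: "R = rep R" if "R \<in> Rs" for R
    proof -
      obtain Q where Q: "R = rep Q" using \<open>R \<in> Rs\<close> unfolding Rs_def by blast
      obtain x where "x \<in> int_Gamma0 n" "rep Q = conj_form x Q" using rep by blast
      hence "form_orbit n R = form_orbit n Q"
        using form_orbit_conj_form[of x n Q] by (simp only: Q)
      hence "rep R = rep Q" by (simp only: rep_def)
      thus ?thesis by (simp only: Q)
    qed
    have "form_orbit n R' = form_orbit n R"
      using form_orbit_conj_form[OF R(3), of R] by (simp add: R(4))
    hence "rep R' = rep R" by (simp add: rep_def)
    thus ?thesis using self_rep[OF R(1)] self_rep[OF R(2)] by metis
  qed
  ultimately show ?thesis
    unfolding F_def[symmetric] using \<open>finite Rs\<close> by (intro exI[of _ Rs] conjI ballI impI)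
qed

section \<open>Geodesics of integral forms\<close>

lemma square_neq_squarefree:
  fixes D x :: int
  assumes "D > 1" "squarefree D"
  shows "x\<^sup>2 \<noteq> D"
proof
  assume "x\<^sup>2 = D"
  hence "is_unit x" using assms(2) by (auto simp: squarefree_def)
  hence "x\<^sup>2 = 1" by (metis abs_1 power2_abs power_one zdvd1_eq)
  thus False using \<open>x\<^sup>2 = D\<close> assms(1) by simp
qed

lemma cong_Gamma_inf_iff: "cong_Gamma_inf z w \<longleftrightarrow> (\<exists>k::int. w = z + of_int k)"
proof -
  have "mobius_act (mat2 1 (of_int k) 0 1) z = z + of_int k" for k
    by (simp add: mobius_act_mat2)
  moreover have "mobius_act (- mat2 1 (of_int k) 0 1) z = z + of_int k" for k
    unfolding mobius_act_uminus by (simp add: mobius_act_mat2)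
  ultimately show ?thesis
    unfolding cong_Gamma_inf_def Gamma_inf_def by fastforce
qed

lemma root_point_eq: "root_point D m \<mu> = Complex (of_int \<mu> / of_int m) (sqrt (of_int D) / of_int m)"
  by (simp add: root_point_def complex_eq_iff Re_divide Im_divide power2_eq_square)

text \<open>Translations preserve the imaginary part, which determines the modulus; an integer shift
  of the real part then changes the numerator by a multiple of \<open>m\<close>.\<close>

lemma cong_Gamma_inf_root_point_iff:
  assumes "D > 0" "A > 0" "m > 0"
  shows "cong_Gamma_inf (root_point D A B) (root_point D m \<mu>) \<longleftrightarrow> A = m \<and> [B = \<mu>] (mod m)"
proof -
  have "sqrt (of_int D) / real_of_int m = sqrt (of_int D) / of_int A \<longleftrightarrow> A = m"
    using assms by (auto simp: field_simps)
  hence "cong_Gamma_inf (root_point D A B) (root_point D m \<mu>) \<longleftrightarrow>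
      (\<exists>k. A = m \<and> real_of_int \<mu> / of_int m = of_int B / of_int m + of_int k)"
    unfolding cong_Gamma_inf_iff by (auto simp: root_point_eq complex_eq_iff)
  moreover have "real_of_int \<mu> / of_int m = of_int B / of_int m + of_int k \<longleftrightarrow> \<mu> = B + m * k" for k
  proof -
    have "real_of_int \<mu> / of_int m = of_int B / of_int m + of_int k \<longleftrightarrow>
        real_of_int \<mu> = of_int (B + m * k)"
      using assms(3) by (simp add: field_simps)
    thus ?thesis by (simp only: of_int_eq_iff)
  qed
  ultimately show ?thesis by (simp add: cong_iff_lin)
qed

section \<open>The geodesic attached to a form\<close>

text \<open>As a Moebius map it sends 0 and \<infinity> to \<open>(B - sqrt D) / A\<close> and
  \<open>(B + sqrt D) / A\<close>. The second column is scaled to give determinant one.\<close>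

definition form_matrix :: "int \<Rightarrow> int \<times> int \<times> int \<Rightarrow> real^2^2" where
  "form_matrix D = (\<lambda>(A, B, C).
     mat2 ((of_int B + sqrt (of_int D)) / of_int A) ((of_int B - sqrt (of_int D)) / (2 * sqrt (of_int D)))
       1 (of_int A / (2 * sqrt (of_int D))))"

definition form_geodesic :: "int \<Rightarrow> int \<times> int \<times> int \<Rightarrow> oriented_curve" where
  "form_geodesic D Q = geodesic_of (form_matrix D Q)"

context
  fixes D :: int
  assumes D_pos: "D > 0" and D_not_square: "\<And>x. x\<^sup>2 \<noteq> D"
begin

lemma form_fst_nonzero: "form_disc (A, B, C) = D \<Longrightarrow> A \<noteq> 0"
  using D_not_square[of B] by auto

text \<open>The axis form of a matrix of determinant one has \<open>B^2 - A * C = 1\<close>, which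
  explains the division of the integral triple by \<open>sqrt D\<close>.\<close>

lemma form_matrix_axis:
  assumes "form_disc (A, B, C) = D"
  shows "form_matrix D (A, B, C) \<in> SL2R"
    and "axis_form (form_matrix D (A, B, C)) =
      (of_int A / sqrt (of_int D), of_int B / sqrt (of_int D), of_int C / sqrt (of_int D))"
proof -
  define w where "w = sqrt (real_of_int D)"
  define a b c where "a = real_of_int A" and "b = real_of_int B" and "c = real_of_int C"
  have w: "w > 0" "w * w = b * b - a * c"
    using D_pos assms by (simp_all add: w_def a_def b_def c_def power2_eq_square flip: of_int_mult of_int_diff)
  have a: "a \<noteq> 0" using form_fst_nonzero[OF assms] by (simp add: a_def)
  have M: "form_matrix D (A, B, C) = mat2 ((b + w) / a) ((b - w) / (2 * w)) 1 (a / (2 * w))"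
    by (simp add: form_matrix_def w_def a_def b_def)
  show "form_matrix D (A, B, C) \<in> SL2R"
    unfolding M mat2_in_SL2R using w a by (simp add: field_simps)
  \<comment> \<open>The only use of the discriminant for the third coefficient:
    \<open>b^2 - w^2 = a * c\<close>.\<close>
  have "(b + w) * (b - w) = a * c" using w by (simp add: algebra_simps)
  moreover have "2 * (u / a) * (v / (2 * w)) = (u * v) / (a * w)" for u v by simp
  ultimately have "2 * ((b + w) / a) * ((b - w) / (2 * w)) = (a * c) / (a * w)" by (simp only:)
  also have "\<dots> = c / w" using a by simp
  finally have "2 * ((b + w) / a) * ((b - w) / (2 * w)) = c / w" .
  moreover have "(b + w) / a * (a / (2 * w)) + (b - w) / (2 * w) * 1 = b / w"
    using w a by (simp add: field_simps)
  ultimately show "axis_form (form_matrix D (A, B, C)) =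
      (of_int A / sqrt (of_int D), of_int B / sqrt (of_int D), of_int C / sqrt (of_int D))"
    unfolding M axis_form_def w_def[symmetric] a_def[symmetric] b_def[symmetric] c_def[symmetric]
    by simp
qed

lemma form_matrix_in_SL2R: "form_disc Q = D \<Longrightarrow> form_matrix D Q \<in> SL2R"
  using form_matrix_axis(1) by (cases Q) simp

lemma oriented_form_geodesic: "form_disc Q = D \<Longrightarrow> oriented_geodesic (form_geodesic D Q)"
  using form_matrix_in_SL2R unfolding oriented_geodesic_def form_geodesic_def by blast

lemma form_geodesic_inj:
  assumes "form_disc Q = D" "form_disc Q' = D" "form_geodesic D Q = form_geodesic D Q'"
  shows "Q = Q'"
proof -
  obtain A B C where Q: "Q = (A, B, C)" by (cases Q)
  obtain A' B' C' where Q': "Q' = (A', B', C')" by (cases Q')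
  have "axis_form (form_matrix D Q) = axis_form (form_matrix D Q')"
    using assms form_matrix_in_SL2R geodesic_of_eq_iff unfolding form_geodesic_def by blast
  thus ?thesis
    using form_matrix_axis(2) assms(1,2) D_pos by (simp add: Q Q')
qed

text \<open>\<open>conj_form\<close> is linear in the triple, so it commutes with the division by
  \<open>sqrt D\<close>; the two geodesics then have equal axis forms.\<close>

lemma act_form_geodesic:
  assumes "x \<in> int_Gamma0 n" "form_disc Q = D"
  shows "act_geodesic (real_mat2 x) (form_geodesic D Q) = form_geodesic D (conj_form x Q)"
proof -
  obtain p q r s where x: "x = (p, q, r, s)" by (cases x)
  obtain A B C where Q: "Q = (A, B, C)" by (cases Q)
  obtain A' B' C' where Q': "conj_form x Q = (A', B', C')" by (cases "conj_form x Q")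
  have eqs: "A' = s\<^sup>2 * A + 2 * r * s * B + r\<^sup>2 * C"
    "B' = q * s * A + (p * s + q * r) * B + p * r * C"
    "C' = q\<^sup>2 * A + 2 * p * q * B + p\<^sup>2 * C"
    using Q' by (auto simp: x Q conj_form_def)
  have disc': "form_disc (conj_form x Q) = D"
    using form_disc_conj_form[OF assms(1)] assms(2) by simp
  have "real_mat2 x \<in> SL2R"
    using assms(1) Gamma0_eq_image Gamma0_subset_SL2R by blast
  hence "real_mat2 x ** form_matrix D Q \<in> SL2R"
    using SL2R_mult form_matrix_in_SL2R[OF assms(2)] by blast
  moreover have "axis_form (real_mat2 x ** form_matrix D Q) = axis_form (form_matrix D (conj_form x Q))"
    using form_matrix_axis(2)[OF assms(2)[unfolded Q]] form_matrix_axis(2)[OF disc'[unfolded Q']]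
    unfolding Q' unfolding x Q real_mat2.simps axis_form_mult
    by (simp add: conj_form_def eqs add_divide_distrib)
  ultimately have "geodesic_of (real_mat2 x ** form_matrix D Q) = geodesic_of (form_matrix D (conj_form x Q))"
    using geodesic_of_eq_iff form_matrix_in_SL2R[OF disc'] by blast
  thus ?thesis
    using act_geodesic_of[OF form_matrix_in_SL2R[OF assms(2)]] by (simp add: form_geodesic_def)
qed

lemma positively_oriented_form_geodesic:
  assumes "form_disc (A, B, C) = D"
  shows "positively_oriented (form_geodesic D (A, B, C)) \<longleftrightarrow> A > 0"
  using positively_oriented_iff[OF form_matrix_axis[OF assms]] form_fst_nonzero[OF assms] D_pos
  by (simp add: form_geodesic_def zero_less_divide_iff)

lemma geodesic_top_form_geodesic:
  assumes "form_disc (A, B, C) = D" "A > 0"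
  shows "geodesic_top (form_geodesic D (A, B, C)) = root_point D A B"
  using geodesic_top_eq[OF form_matrix_axis[OF assms(1)]] assms(2) D_pos
  by (simp add: form_geodesic_def root_point_eq)

text \<open>A form is determined by its geodesic, and the two actions correspond, so fixing the
  oriented geodesic means fixing the form.\<close>

lemma geodesic_stabilizer_form_geodesic:
  assumes "form_disc Q = D"
  shows "geodesic_stabilizer n (form_geodesic D Q) = real_mat2 ` {x \<in> int_Gamma0 n. conj_form x Q = Q}"
proof -
  have "act_geodesic (real_mat2 x) (form_geodesic D Q) = form_geodesic D Q \<longleftrightarrow> conj_form x Q = Q"
    if "x \<in> int_Gamma0 n" for x
    using form_geodesic_inj[of "conj_form x Q" Q] form_disc_conj_form[OF that, of Q]
      act_form_geodesic[OF that assms] assms by metis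
  thus ?thesis
    unfolding geodesic_stabilizer_eq[OF oriented_form_geodesic[OF assms]] Gamma0_eq_image by blast
qed

text \<open>The dictionary between geometry and congruences. Positive orientation needs no separate
  mention on the right, as \<open>A = m\<close> and \<open>m > 0\<close> imply it.\<close>

lemma top_form_geodesic_cong_iff:
  assumes "x \<in> int_Gamma0 n" "form_disc Q = D" "conj_form x Q = (A, B, C)" "m > 0"
  shows "positively_oriented (act_geodesic (real_mat2 x) (form_geodesic D Q)) \<and>
      cong_Gamma_inf (geodesic_top (act_geodesic (real_mat2 x) (form_geodesic D Q))) (root_point D m \<mu>)
    \<longleftrightarrow> A = m \<and> [B = \<mu>] (mod m)"
proof -
  have disc: "form_disc (A, B, C) = D"
    using form_disc_conj_form[OF assms(1), of Q] assms(2,3) by (simp only:)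
  show ?thesis
    unfolding act_form_geodesic[OF assms(1,2)] assms(3) positively_oriented_form_geodesic[OF disc]
    using geodesic_top_form_geodesic[OF disc] cong_Gamma_inf_root_point_iff[OF D_pos _ assms(4)] assms(4)
    by (metis (no_types))
qed

end

section \<open>Equality of double cosets\<close>

text \<open>The outer factors are absorbed into \<open>A\<close> and \<open>B\<close>; the one-sided
  inverses supplied for them give the reverse inclusion.\<close>

lemma double_coset_eq:
  assumes A: "\<And>x y. x \<in> A \<Longrightarrow> y \<in> A \<Longrightarrow> x ** y \<in> A"
    and B: "\<And>x y. x \<in> B \<Longrightarrow> y \<in> B \<Longrightarrow> x ** y \<in> B"
    and \<tau>: "\<tau> \<in> A" "\<tau>' \<in> A" "\<tau>' ** \<tau> = mat 1"
    and \<beta>: "\<beta> \<in> B" "\<beta>' \<in> B" "\<beta> ** \<beta>' = mat 1"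
  shows "double_coset A (\<tau> ** \<gamma> ** \<beta>) B = double_coset A \<gamma> B"
proof (rule set_eqI, rule iffI)
  fix X assume "X \<in> double_coset A (\<tau> ** \<gamma> ** \<beta>) B"
  then obtain a b where "a \<in> A" "b \<in> B" "X = a ** (\<tau> ** \<gamma> ** \<beta>) ** b"
    unfolding double_coset_def by blast
  hence "a ** \<tau> \<in> A" "\<beta> ** b \<in> B" "X = (a ** \<tau>) ** \<gamma> ** (\<beta> ** b)"
    using A B \<tau> \<beta> by (simp_all add: matrix_mul_assoc)
  thus "X \<in> double_coset A \<gamma> B" unfolding double_coset_def by blast
next
  fix X assume "X \<in> double_coset A \<gamma> B"
  then obtain a b where ab: "a \<in> A" "b \<in> B" "X = a ** \<gamma> ** b"
    unfolding double_coset_def by blast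
  have "(a ** \<tau>') ** (\<tau> ** \<gamma> ** \<beta>) ** (\<beta>' ** b) = a ** (\<tau>' ** \<tau>) ** \<gamma> ** (\<beta> ** \<beta>') ** b"
    by (simp add: matrix_mul_assoc)
  hence "X = (a ** \<tau>') ** (\<tau> ** \<gamma> ** \<beta>) ** (\<beta>' ** b)" using ab \<tau> \<beta> by simp
  moreover have "a ** \<tau>' \<in> A" "\<beta>' ** b \<in> B" using ab A B \<tau> \<beta> by simp_all
  ultimately show "X \<in> double_coset A (\<tau> ** \<gamma> ** \<beta>) B" unfolding double_coset_def by blast
qed

lemma Gamma_inf_mult:
  assumes "x \<in> Gamma_inf" "y \<in> Gamma_inf"
  shows "x ** y \<in> Gamma_inf"
proof -
  obtain k l :: int where
    "x = mat2 1 (of_int k) 0 1 \<or> x = - mat2 1 (of_int k) 0 1"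
    "y = mat2 1 (of_int l) 0 1 \<or> y = - mat2 1 (of_int l) 0 1"
    using assms unfolding Gamma_inf_def by blast
  moreover have "mat2 1 (of_int k) 0 1 ** mat2 1 (of_int l) 0 1 = mat2 1 (of_int (k + l)) 0 1"
    by simp
  ultimately have "x ** y = mat2 1 (of_int (k + l)) 0 1 \<or> x ** y = - mat2 1 (of_int (k + l)) 0 1"
    by (elim disjE) (simp_all del: mat2_mult mat2_uminus)
  thus ?thesis unfolding Gamma_inf_def by blast
qed

text \<open>With \<open>T\<close> the translation by \<open>k\<close>, the element
  \<open>z = (T y)^-1 x\<close> fixes \<open>R\<close>. Hence \<open>x = T y z\<close> with
  \<open>T\<close> in \<open>Gamma_inf\<close> and \<open>z\<close> in the stabilizer.\<close>

lemma double_coset_eq_if_translate: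
  assumes "D > 0" "\<And>x. x\<^sup>2 \<noteq> D" "form_disc R = D" "x \<in> int_Gamma0 n" "y \<in> int_Gamma0 n"
    and "conj_form x R = conj_form (1, k, 0, 1) (conj_form y R)"
  shows "double_coset Gamma_inf (real_mat2 x) (geodesic_stabilizer n (form_geodesic D R)) =
    double_coset Gamma_inf (real_mat2 y) (geodesic_stabilizer n (form_geodesic D R))"
proof -
  define S where "S = {z \<in> int_Gamma0 n. conj_form z R = R}"
  define T T' :: int_mat2 where "T = (1, k, 0, 1)" and "T' = (1, - k, 0, 1)"
  have T: "T \<in> int_Gamma0 n" by (simp add: T_def int_Gamma0_def)
  define z where "z = int_mat2_mult (int_mat2_adjugate (int_mat2_mult T y)) x"
  have Ty: "int_mat2_mult T y \<in> int_Gamma0 n" using int_Gamma0_mult T assms(5) .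
  have z: "z \<in> int_Gamma0 n"
    unfolding z_def by (intro int_Gamma0_mult int_Gamma0_adjugate T assms)
  have "conj_form (int_mat2_mult T y) R = conj_form x R"
    using assms(6) by (simp only: conj_form_mult T_def)
  hence zR: "conj_form z R = R"
    using conj_form_adjugate(1)[OF Ty, of R] by (simp only: z_def conj_form_mult)
  have S_mult: "u ** v \<in> real_mat2 ` S" if mem: "u \<in> real_mat2 ` S" "v \<in> real_mat2 ` S" for u v
  proof -
    obtain u' v' where uv: "u' \<in> S" "v' \<in> S" "u = real_mat2 u'" "v = real_mat2 v'"
      using mem by blast
    hence "int_mat2_mult u' v' \<in> S"
      unfolding S_def using int_Gamma0_mult by (simp add: conj_form_mult)
    thus ?thesis using uv real_mat2_mult by (metis image_eqI)
  qed
  have one: "real_mat2 (1, 0, 0, 1) = mat 1" by (simp add: mat_1_eq_mat2)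
  have adj: "real_mat2 u ** real_mat2 (int_mat2_adjugate u) = mat 1"
    "real_mat2 (int_mat2_adjugate u) ** real_mat2 u = mat 1" if "u \<in> int_Gamma0 n" for u
    using int_mat2_adjugate_mult[OF that] one by (simp_all only: flip: real_mat2_mult)
  have x: "real_mat2 T ** real_mat2 y ** real_mat2 z = real_mat2 x"
  proof -
    have "real_mat2 T ** real_mat2 y ** real_mat2 z =
        real_mat2 (int_mat2_mult T y) ** real_mat2 (int_mat2_adjugate (int_mat2_mult T y)) ** real_mat2 x"
      by (simp only: z_def real_mat2_mult matrix_mul_assoc)
    thus ?thesis by (simp only: adj[OF Ty] matrix_mul_lid)
  qed
  have "conj_form (int_mat2_adjugate z) R = R"
    using conj_form_adjugate(1)[OF z, of R] by (simp only: zR)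
  hence zS: "z \<in> S" "int_mat2_adjugate z \<in> S"
    using z zR int_Gamma0_adjugate unfolding S_def by blast+
  have "double_coset Gamma_inf (real_mat2 T ** real_mat2 y ** real_mat2 z) (real_mat2 ` S) =
      double_coset Gamma_inf (real_mat2 y) (real_mat2 ` S)"
  proof (rule double_coset_eq[OF Gamma_inf_mult S_mult])
    have "real_mat2 (1, l, 0, 1) \<in> Gamma_inf" for l
      unfolding Gamma_inf_def by (simp del: mat2_uminus) blast
    thus "real_mat2 T \<in> Gamma_inf" "real_mat2 T' \<in> Gamma_inf" by (simp_all only: T_def T'_def)
    show "real_mat2 T' ** real_mat2 T = mat 1"
      by (simp add: T_def T'_def mat_1_eq_mat2)
    show "real_mat2 z \<in> real_mat2 ` S" "real_mat2 (int_mat2_adjugate z) \<in> real_mat2 ` S"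
      using zS by (auto intro: imageI)
    show "real_mat2 z ** real_mat2 (int_mat2_adjugate z) = mat 1" by (rule adj(1)[OF z])
  qed
  moreover have "geodesic_stabilizer n (form_geodesic D R) = real_mat2 ` S"
    unfolding S_def by (rule geodesic_stabilizer_form_geodesic[OF assms(1-3)])
  ultimately show ?thesis by (simp only: x)
qed

section \<open>The correspondence between roots and double cosets\<close>

theorem theorem1p1:
  fixes D n \<nu> :: int
  assumes "D > 1" and "squarefree D" and "[D = 1] (mod 4)"
    and "n \<ge> 1" and "[\<nu>\<^sup>2 = D] (mod n)"
  shows "\<exists>C :: oriented_curve set. finite C \<and> (\<forall>c\<in>C. oriented_geodesic c) \<and>
    (\<forall>m \<mu> :: int. admissible_root D n \<nu> m \<mu> \<longrightarrow>
      (\<exists>!(c, X). c \<in> C \<and>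
        (\<exists>\<gamma>\<in>Gamma0 n. X = double_coset Gamma_inf \<gamma> (geodesic_stabilizer n c) \<and>
          positively_oriented (act_geodesic \<gamma> c) \<and>
          cong_Gamma_inf (geodesic_top (act_geodesic \<gamma> c)) (root_point D m \<mu>)))) \<and>
    (\<forall>c\<in>C. \<forall>\<gamma>\<in>Gamma0 n. positively_oriented (act_geodesic \<gamma> c) \<longrightarrow>
      (\<exists>!(m, M). \<exists>\<mu>. M = residue_class m \<mu> \<and> admissible_root D n \<nu> m \<mu> \<and>
          cong_Gamma_inf (geodesic_top (act_geodesic \<gamma> c)) (root_point D m \<mu>)))"
proof -
  have D: "D > 0" and D_sq: "x\<^sup>2 \<noteq> D" for x
    using assms square_neq_squarefree by auto
  have "n > 0" using assms by simp
  from ex_finite_form_representatives[OF D D_sq this, of \<nu>]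
  obtain Rs where Rs: "finite Rs" "Rs \<subseteq> root_forms D n \<nu>"
    and Rs_ex: "\<forall>Q\<in>root_forms D n \<nu>. \<exists>R\<in>Rs. \<exists>x\<in>int_Gamma0 n. conj_form x R = Q"
    and Rs_unique: "\<forall>R\<in>Rs. \<forall>R'\<in>Rs. \<forall>x\<in>int_Gamma0 n. conj_form x R = R' \<longrightarrow> R = R'"
    by (elim exE conjE)
  have disc: "form_disc R = D" if "R \<in> Rs" for R
  proof -
    have "R \<in> root_forms D n \<nu>" using Rs(2) that by (rule subsetD)
    thus ?thesis by (cases R) (simp add: root_forms_def)
  qed
  note cong_iff = top_form_geodesic_cong_iff[OF D D_sq]
  define P where "P m \<mu> c X \<longleftrightarrow>
    (\<exists>\<gamma>\<in>Gamma0 n. X = double_coset Gamma_inf \<gamma> (geodesic_stabilizer n c) \<and>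
      positively_oriented (act_geodesic \<gamma> c) \<and>
      cong_Gamma_inf (geodesic_top (act_geodesic \<gamma> c)) (root_point D m \<mu>))" for m \<mu> c X
  have "\<exists>!(c, X). c \<in> form_geodesic D ` Rs \<and> P m \<mu> c X"
    if adm: "admissible_root D n \<nu> m \<mu>" for m \<mu>
  proof -
    have m: "m > 0" and "m dvd \<mu>\<^sup>2 - D" "n dvd m" "[\<mu> = \<nu>] (mod n)"
      using adm by (auto simp: admissible_root_def cong_iff_dvd_diff)
    then obtain C0 where C0: "\<mu>\<^sup>2 - D = m * C0" by blast
    \<comment> \<open>The form of the root lies in the orbit of some representative
      \<open>R\<close>, and the matrix carrying \<open>R\<close> to it yields the double
      coset.\<close>
    define Q where "Q = (m, \<mu>, C0)"
    have "Q \<in> root_forms D n \<nu>"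
      using C0 \<open>n dvd m\<close> \<open>[\<mu> = \<nu>] (mod n)\<close> by (simp add: Q_def root_forms_def)
    then obtain R x where R: "R \<in> Rs" and x: "x \<in> int_Gamma0 n" "conj_form x R = Q"
      using Rs_ex by blast
    define X where "X = double_coset Gamma_inf (real_mat2 x) (geodesic_stabilizer n (form_geodesic D R))"
    have "P m \<mu> (form_geodesic D R) X"
      unfolding P_def X_def Gamma0_eq_image
      using cong_iff[OF x(1) disc[OF R] x(2)[unfolded Q_def] m, of \<mu>] x(1) by auto
    moreover have "c' = form_geodesic D R \<and> X' = X"
      if "c' \<in> form_geodesic D ` Rs" "P m \<mu> c' X'" for c' X'
    proof -
      obtain R' where R': "R' \<in> Rs" "c' = form_geodesic D R'"
        using \<open>c' \<in> form_geodesic D ` Rs\<close> by (rule imageE)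
      obtain \<gamma> where "\<gamma> \<in> Gamma0 n"
        and \<gamma>: "X' = double_coset Gamma_inf \<gamma> (geodesic_stabilizer n c')"
          "positively_oriented (act_geodesic \<gamma> c') \<and>
           cong_Gamma_inf (geodesic_top (act_geodesic \<gamma> c')) (root_point D m \<mu>)"
        using \<open>P m \<mu> c' X'\<close> unfolding P_def by blast
      then obtain y where y: "y \<in> int_Gamma0 n" "\<gamma> = real_mat2 y"
        unfolding Gamma0_eq_image by blast
      obtain A B C where Q': "conj_form y R' = (A, B, C)" by (cases "conj_form y R'")
      have "A = m" "[B = \<mu>] (mod m)"
        using cong_iff[OF y(1) disc[OF R'(1)] Q' m, of \<mu>] \<gamma>(2) unfolding R'(2) y(2) by blast+
      then obtain k where k: "\<mu> = B + m * k" using cong_iff_lin by blast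
      \<comment> \<open>\<open>B\<close> agrees with \<open>\<mu>\<close> only modulo
        \<open>m\<close>; this translation makes the middle coefficients equal.\<close>
      define T where "T = (1::int, k, 0::int, 1::int)"
      have T: "T \<in> int_Gamma0 n" by (simp add: T_def int_Gamma0_def)
      define C' where "C' = k\<^sup>2 * m + 2 * k * B + C"
      have TQ: "conj_form T (conj_form y R') = (m, \<mu>, C')"
        unfolding Q' T_def C'_def k \<open>A = m\<close> by (simp add: conj_form_def)
      have "form_disc (conj_form T (conj_form y R')) = D"
        using disc[OF R'(1)] by (simp only: form_disc_conj_form[OF T] form_disc_conj_form[OF y(1)])
      hence "\<mu>\<^sup>2 - m * C' = D" by (simp only: TQ form_disc.simps)
      \<comment> \<open>Both forms have discriminant \<open>D\<close> and share the first two
        coefficients; as \<open>m > 0\<close>, the third agrees too.\<close>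
      hence "m * C' = m * C0" using C0 by linarith
      hence eq: "conj_form x R = conj_form T (conj_form y R')"
        using m by (simp add: TQ x(2) Q_def)
      \<comment> \<open>\<open>z\<close> carries \<open>R'\<close> to \<open>R\<close>, so the two
        representatives coincide, and the double cosets are then compared over a single
        geodesic.\<close>
      define z where "z = int_mat2_mult (int_mat2_adjugate x) (int_mat2_mult T y)"
      have "z \<in> int_Gamma0 n"
        unfolding z_def by (intro int_Gamma0_mult int_Gamma0_adjugate x(1) T y(1))
      moreover have "conj_form z R' = R"
        using conj_form_adjugate(1)[OF x(1), of R] by (simp only: z_def conj_form_mult eq)
      ultimately have "R' = R" using Rs_unique R R'(1) by blast
      moreover have "X = double_coset Gamma_inf \<gamma> (geodesic_stabilizer n (form_geodesic D R))"
        unfolding X_def y(2)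
        by (rule double_coset_eq_if_translate[OF D D_sq disc[OF R] x(1) y(1)
              eq[unfolded T_def \<open>R' = R\<close>]])
      ultimately show ?thesis using R'(2) \<gamma>(1) by simp
    qed
    ultimately show ?thesis
      using R by (intro ex1I[of _ "(form_geodesic D R, X)"]) auto
  qed
  moreover have "\<exists>!(m, M). \<exists>\<mu>. M = residue_class m \<mu> \<and> admissible_root D n \<nu> m \<mu> \<and>
      cong_Gamma_inf (geodesic_top (act_geodesic \<gamma> c)) (root_point D m \<mu>)"
    if c: "c \<in> form_geodesic D ` Rs" and \<gamma>: "\<gamma> \<in> Gamma0 n" and pos: "positively_oriented (act_geodesic \<gamma> c)"
    for c \<gamma>
  proof -
    obtain R where R: "R \<in> Rs" "c = form_geodesic D R" using c by (rule imageE)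
    obtain x where x: "x \<in> int_Gamma0 n" "\<gamma> = real_mat2 x"
      using \<gamma> unfolding Gamma0_eq_image by blast
    obtain A B C where Q: "conj_form x R = (A, B, C)" by (cases "conj_form x R")
    have "R \<in> root_forms D n \<nu>" using Rs(2) R(1) by (rule subsetD)
    from conj_form_in_root_forms[OF x(1) this]
    have AB: "B\<^sup>2 - A * C = D" "n dvd A" "[B = \<nu>] (mod n)"
      unfolding Q by (auto simp: root_forms_def)
    \<comment> \<open>Positive orientation of the translate is what makes its leading coefficient a
      valid modulus.\<close>
    have "A > 0"
      using pos positively_oriented_form_geodesic[OF D D_sq, of A B C] AB(1)
      unfolding R(2) x(2) act_form_geodesic[OF D D_sq x(1) disc[OF R(1)]] Q by simp
    have "B\<^sup>2 - D = A * C" using AB(1) by simp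
    hence "[B\<^sup>2 = D] (mod A)" by (simp add: cong_iff_dvd_diff)
    hence adm: "admissible_root D n \<nu> A B"
      using \<open>A > 0\<close> AB by (simp add: admissible_root_def cong_0_iff)
    have iff: "cong_Gamma_inf (geodesic_top (act_geodesic \<gamma> c)) (root_point D m \<mu>) \<longleftrightarrow>
        A = m \<and> [B = \<mu>] (mod m)" if "m > 0" for m \<mu>
      using cong_iff[OF x(1) disc[OF R(1)] Q that, of \<mu>] pos unfolding R(2) x(2) by blast
    \<comment> \<open>The root is read off the first two coefficients of the translated form, and by
      \<open>iff\<close> any other candidate has the same modulus and residue class.\<close>
    show ?thesis
    proof (rule ex1I[of _ "(A, residue_class A B)"])
      show "case (A, residue_class A B) of (m, M) \<Rightarrow>
          \<exists>\<mu>. M = residue_class m \<mu> \<and> admissible_root D n \<nu> m \<mu> \<and>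
            cong_Gamma_inf (geodesic_top (act_geodesic \<gamma> c)) (root_point D m \<mu>)"
        using adm iff[OF \<open>A > 0\<close>, of B] by auto
    next
      fix p assume p: "case p of (m, M) \<Rightarrow>
          \<exists>\<mu>. M = residue_class m \<mu> \<and> admissible_root D n \<nu> m \<mu> \<and>
            cong_Gamma_inf (geodesic_top (act_geodesic \<gamma> c)) (root_point D m \<mu>)"
      obtain m M where mM: "p = (m, M)" by (cases p)
      obtain \<mu> where \<mu>: "M = residue_class m \<mu>" "admissible_root D n \<nu> m \<mu>"
        "cong_Gamma_inf (geodesic_top (act_geodesic \<gamma> c)) (root_point D m \<mu>)"
        using p unfolding mM by auto
      have "m > 0" using \<mu>(2) by (simp add: admissible_root_def)
      hence "A = m" "[B = \<mu>] (mod m)" using \<mu>(3) iff by auto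
      thus "p = (A, residue_class A B)"
        by (auto simp: mM \<mu>(1) residue_class_def intro: cong_trans cong_sym)
    qed
  qed
  moreover have "\<forall>c\<in>form_geodesic D ` Rs. oriented_geodesic c"
    using oriented_form_geodesic[OF D D_sq] disc by blast
  ultimately show ?thesis
    unfolding P_def using Rs(1) by (intro exI[of _ "form_geodesic D ` Rs"] conjI allI impI ballI) auto
qed

end
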